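(* There is a constant $C>0$, independent of $\epsilon$ and $T$, such that the following holds for $T\gg1$ and $0<\epsilon\ll1$. Let $\alpha\in\Gamma$ with $\alpha\notin\Gamma_{\mathrm{T}_R(\tilde\gamma)}$, and assume that $\tilde\gamma$ and $\alpha(\tilde\gamma)$ are not contained in a common plane. Then $$\inf|\phi''_{st}|\ge\epsilon^2e^{-CT},$$ where the infimum is taken on $([0,1]\times I)\setminus Z_\epsilon$. If $Z\neq\emptyset$, then $$\inf\,|\phi''_{st}|/|t-t_c(s)|\ge\epsilon e^{-CT},$$ where the infimum is taken on $([0,1]\times I)\cap\{(t,s)\in Z_\epsilon: s>s_++\epsilon\ \text{or}\ s<s_--\epsilon\}$, and $$\inf\,|\phi''_{st}|/|s-s_c(t)|\ge\epsilon e^{-CT},$$ where the infimum is taken on $([0,1]\times I)\cap\{(t,s)\in Z_\epsilon: t>t_++\epsilon\ \text{or}\ t<t_--\epsilon\}$.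
   Context: Setting. $(M,g)$ is a compact 3-dimensional Riemannian manifold of constant curvature $-1$ with sufficiently large injectivity radius $\mathrm{Inj}\,M$; its universal cover is $\mathbb{H}^3$, with metric $\tilde g$ and distance $d_{\tilde g}$; $\Gamma$ is the group of deck transformations. $\gamma(t)$, $t\in[0,1]$, is a fixed unit-length geodesic segment of $M$ parameterized by arclength, $\tilde\gamma(t)$, $t\in\mathbb{R}$, is a lift to $\mathbb{H}^3$ of the unit-speed geodesic containing it, and $D\subset\mathbb{H}^3$ is a Dirichlet fundamental domain for $M$ centered at $\tilde\gamma(0)$. Fix $R\approx\mathrm{Inj}\,M$ and put $$\mathrm{T}_R(\tilde\gamma)=\{p\in\mathbb{H}^3: d_{\tilde g}(p,\tilde\gamma)\le R\},\qquad \Gamma_{\mathrm{T}_R(\tilde\gamma)}=\{\alpha\in\Gamma:\alpha(D)\cap\mathrm{T}_R(\tilde\gamma)\neq\emptyset\}.$$ Standing assumption on $\alpha$ and $T$: $2\le d_{\tilde g}(\tilde\gamma(t),\alpha(\tilde\gamma(s)))\le T$ for all $s,t\in[0,1]$. Coordinates. Use the Poincaré half-space model $\mathbb{H}^3=\{(x,y,z):z>0\}$ with metric $z^{-2}(dx^2+dy^2+dz^2)$. When $\tilde\gamma$ and $\alpha(\tilde\gamma)$ are not contained in a common plane (totally geodesic hyperbolic plane), coordinates can be chosen by an isometry so that $\tilde\gamma(t)=\gamma_1(t)=(0,0,e^t)$ and, for some $a\ge0$, $r>0$, $\beta\in(0,\frac\pi2]$ and some closed interval $I\subset\mathbb{R}$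 of length one, $$\{\alpha(\tilde\gamma(s)):s\in[0,1]\}=\{\gamma_2(s):s\in I\},\quad \gamma_2(s)=\Big(a+\tfrac{1-e^{2s}}{1+e^{2s}}r\cos\beta,\ \tfrac{1-e^{2s}}{1+e^{2s}}r\sin\beta,\ \tfrac{2re^s}{1+e^{2s}}\Big).$$ Both $\gamma_1$ and $\gamma_2$ are parameterized by arclength, and $\gamma_2(s)$, $s\in\mathbb{R}$, parameterizes the half-circle $\alpha(\tilde\gamma)$. Put $\phi(t,s)=d_{\tilde g}(\gamma_1(t),\gamma_2(s))$ and $\phi''_{st}=\partial_s\partial_t\phi$. Zero set. Let $Z=\{(t,s)\in\mathbb{R}^2:\phi''_{st}(t,s)=0\}$, and let $Z_\epsilon=\{(t,s)\in\mathbb{R}^2:\mathrm{dist}((t,s),Z)\le\epsilon\}$ (with $Z_\epsilon=\emptyset$ if $Z=\emptyset$). One has $Z=\emptyset$ if $r\le a\cos\beta$. If $r>a\cos\beta$, set $d_1=\sqrt{a^2+r^2-2ar\cos\beta}$, $$Y_0=\frac{r+a\cos\beta}{r-a\cos\beta},\qquad X_0=d_1^2Y_0,\qquad B=\frac{4a^3r\cos\beta\sin^2\beta}{(r-a\cos\beta)^2};$$ then $Z=\{(t,s)\in\mathbb{R}^2:(e^{2t}-X_0)(e^{2s}-Y_0)=B\}$. Define $t_\pm$, $s_\pm$ by $$e^{2t_\pm}=X_0\pm\sqrt{\frac{BX_0}{Y_0}},\qquad e^{2s_\pm}=Y_0\pm\sqrt{\frac{BY_0}{X_0}}.$$ If $s>s_+$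 or $s<s_-$, $t_c(s)$ is the unique number with $(t_c(s),s)\in Z$, namely $e^{2t_c(s)}=X_0+\frac{B}{e^{2s}-Y_0}$ (for $\beta=\frac\pi2$, where $B=0$, this means $e^{2t_c}=X_0$). If $t>t_+$ or $t<t_-$, $s_c(t)$ is the unique number with $(t,s_c(t))\in Z$, namely $e^{2s_c(t)}=Y_0+\frac{B}{e^{2t}-X_0}$. *)

theory Defs
  imports "HOL-Analysis.Analysis"
begin

section \<open>The upper half-space model of hyperbolic 3-space\<close>

definition H3 :: "(real^3) set" where
  "H3 = {p. p $ 3 > 0}"

text \<open>
  The Riemannian distance of the metric \<open>z\<^sup>-\<^sup>2 (dx\<^sup>2 + dy\<^sup>2 + dz\<^sup>2)\<close>: the infimum of the lengths of
  \<open>C\<^sup>1\<close> curves. The predicate \<^const>\<open>piecewise_C1_differentiable_on\<close> is avoided on purpose: it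
  admits curves whose speed is not integrable near a break point, and the integral of such a
  speed is 0 in HOL.
\<close>

definition hlength :: "(real \<Rightarrow> real^3) \<Rightarrow> real" where
  "hlength c = integral {0..1} (\<lambda>u. norm (vector_derivative c (at u)) / (c u $ 3))"

definition hdist :: "real^3 \<Rightarrow> real^3 \<Rightarrow> real" where
  "hdist p q = Inf {hlength c | c. c C1_differentiable_on {0..1} \<and> c ` {0..1} \<subseteq> H3 \<and>
                                    c 0 = p \<and> c 1 = q}"

definition hball :: "real^3 \<Rightarrow> real \<Rightarrow> (real^3) set" where
  "hball x r = {y \<in> H3. hdist x y < r}"

definition hisometry :: "(real^3 \<Rightarrow> real^3) \<Rightarrow> bool" where
  "hisometry \<Psi> \<longleftrightarrow> bij_betw \<Psi> H3 H3 \<and> (\<forall>x\<in>H3. \<forall>y\<in>H3. hdist (\<Psi> x) (\<Psi> y) = hdist x y)"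

text \<open>Unit-speed geodesics, as curves that locally realise the distance.\<close>

definition unit_speed_geodesic :: "(real \<Rightarrow> real^3) \<Rightarrow> bool" where
  "unit_speed_geodesic c \<longleftrightarrow> range c \<subseteq> H3 \<and>
     (\<forall>t. \<exists>\<delta>>0. \<forall>u\<in>ball t \<delta>. \<forall>v\<in>ball t \<delta>. hdist (c u) (c v) = \<bar>u - v\<bar>)"

text \<open>
  Totally geodesic hyperbolic planes: the isometry group of hyperbolic space acts transitively on
  them, and the vertical half-plane \<open>y = 0\<close> is one of them.
\<close>

definition hplane :: "(real^3) set \<Rightarrow> bool" where
  "hplane P \<longleftrightarrow> (\<exists>\<Psi>. hisometry \<Psi> \<and> P = \<Psi> ` {p \<in> H3. p $ 2 = 0})"

definition coplanar_sets :: "(real^3) set \<Rightarrow> (real^3) set \<Rightarrow> bool" where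
  "coplanar_sets S S' \<longleftrightarrow> (\<exists>P. hplane P \<and> S \<subseteq> P \<and> S' \<subseteq> P)"


section \<open>Compact hyperbolic 3-manifolds\<close>

text \<open>
  A compact 3-manifold of constant curvature -1 is given together with its universal covering
  \<open>p\<close> by hyperbolic space, a covering map that is locally isometric. Being locally isometric,
  \<open>p\<close> determines the Riemannian metric of \<open>M\<close>. Connectedness of \<open>M\<close> is automatic.
\<close>

definition compact_hyperbolic_3manifold ::
    "'m::metric_space set \<Rightarrow> (real^3 \<Rightarrow> 'm) \<Rightarrow> bool" where
  "compact_hyperbolic_3manifold M p \<longleftrightarrow> compact M \<and> covering_space H3 p M \<and>
     (\<forall>x\<in>H3. \<exists>\<delta>>0. \<forall>y\<in>hball x \<delta>. \<forall>z\<in>hball x \<delta>. dist (p y) (p z) = hdist y z)"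

text \<open>
  Via \<open>p\<close> and the exponential map of hyperbolic space (a diffeomorphism mapping balls around 0
  onto hyperbolic balls), the exponential map of \<open>M\<close> at \<open>p x\<close> is injective on the ball of radius
  \<open>r\<close> iff \<open>p\<close> is injective on \<^term>\<open>hball x r\<close>.
\<close>

definition inj_radius_at :: "(real^3 \<Rightarrow> 'm) \<Rightarrow> real^3 \<Rightarrow> ereal" where
  "inj_radius_at p x = Sup {ereal r | r. inj_on p (hball x r)}"

definition inj_radius :: "(real^3 \<Rightarrow> 'm) \<Rightarrow> ereal" where
  "inj_radius p = (INF x\<in>H3. inj_radius_at p x)"

text \<open>Values of deck transformations outside \<^const>\<open>H3\<close> are irrelevant and left arbitrary.\<close>

definition deck :: "(real^3 \<Rightarrow> 'm) \<Rightarrow> (real^3 \<Rightarrow> real^3) set" where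
  "deck p = {\<alpha>. (\<exists>\<beta>. homeomorphism H3 H3 \<alpha> \<beta>) \<and> (\<forall>x\<in>H3. p (\<alpha> x) = p x)}"

definition dirichlet_domain :: "(real^3 \<Rightarrow> 'm) \<Rightarrow> real^3 \<Rightarrow> (real^3) set" where
  "dirichlet_domain p c = {x \<in> H3. \<forall>\<alpha>\<in>deck p. hdist x c \<le> hdist x (\<alpha> c)}"

definition tube :: "real \<Rightarrow> (real \<Rightarrow> real^3) \<Rightarrow> (real^3) set" where
  "tube R c = {q \<in> H3. (INF t. hdist q (c t)) \<le> R}"

definition deck_tube :: "(real^3 \<Rightarrow> 'm) \<Rightarrow> real \<Rightarrow> (real \<Rightarrow> real^3) \<Rightarrow> (real^3 \<Rightarrow> real^3) set" where
  "deck_tube p R c = {\<alpha> \<in> deck p. \<alpha> ` dirichlet_domain p (c 0) \<inter> tube R c \<noteq> {}}"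


section \<open>Coordinates for a pair of geodesics\<close>

definition \<gamma>1 :: "real \<Rightarrow> real^3" where
  "\<gamma>1 t = vector [0, 0, exp t]"

definition \<gamma>2 :: "real \<Rightarrow> real \<Rightarrow> real \<Rightarrow> real \<Rightarrow> real^3" where
  "\<gamma>2 a r \<beta> s = vector
     [a + (1 - exp (2 * s)) / (1 + exp (2 * s)) * r * cos \<beta>,
      (1 - exp (2 * s)) / (1 + exp (2 * s)) * r * sin \<beta>,
      2 * r * exp s / (1 + exp (2 * s))]"

text \<open>
  \<open>\<Psi>\<close> is a choice of coordinates adapted to \<open>c\<close> and \<open>\<alpha> \<circ> c\<close>, with \<open>I = {b..b+1}\<close>.
\<close>

definition adapted_coordinates ::
    "(real^3 \<Rightarrow> real^3) \<Rightarrow> (real \<Rightarrow> real^3) \<Rightarrow> (real^3 \<Rightarrow> real^3) \<Rightarrow>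
     real \<Rightarrow> real \<Rightarrow> real \<Rightarrow> real \<Rightarrow> bool" where
  "adapted_coordinates \<Psi> c \<alpha> a r \<beta> b \<longleftrightarrow>
     hisometry \<Psi> \<and> a \<ge> 0 \<and> r > 0 \<and> 0 < \<beta> \<and> \<beta> \<le> pi / 2 \<and>
     (\<forall>t. \<Psi> (c t) = \<gamma>1 t) \<and>
     (\<lambda>s. \<Psi> (\<alpha> (c s))) ` {0..1} = \<gamma>2 a r \<beta> ` {b..b+1} \<and>
     range (\<lambda>s. \<Psi> (\<alpha> (c s))) = range (\<gamma>2 a r \<beta>)"

definition \<phi> :: "real \<Rightarrow> real \<Rightarrow> real \<Rightarrow> real \<Rightarrow> real \<Rightarrow> real" where
  "\<phi> a r \<beta> t s = hdist (\<gamma>1 t) (\<gamma>2 a r \<beta> s)"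

definition \<phi>st :: "real \<Rightarrow> real \<Rightarrow> real \<Rightarrow> real \<Rightarrow> real \<Rightarrow> real" where
  "\<phi>st a r \<beta> t s = deriv (\<lambda>s'. deriv (\<lambda>t'. \<phi> a r \<beta> t' s') t) s"

definition Zset :: "real \<Rightarrow> real \<Rightarrow> real \<Rightarrow> (real \<times> real) set" where
  "Zset a r \<beta> = {(t, s). \<phi>st a r \<beta> t s = 0}"

text \<open>The guard is needed since \<^term>\<open>infdist x {} = 0\<close>.\<close>

definition Znbhd :: "real \<Rightarrow> real \<Rightarrow> real \<Rightarrow> real \<Rightarrow> (real \<times> real) set" where
  "Znbhd a r \<beta> \<epsilon> = {x. Zset a r \<beta> \<noteq> {} \<and> infdist x (Zset a r \<beta>) \<le> \<epsilon>}"

definition Y0 :: "real \<Rightarrow> real \<Rightarrow> real \<Rightarrow> real" where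
  "Y0 a r \<beta> = (r + a * cos \<beta>) / (r - a * cos \<beta>)"

definition d1 :: "real \<Rightarrow> real \<Rightarrow> real \<Rightarrow> real" where
  "d1 a r \<beta> = sqrt (a^2 + r^2 - 2 * a * r * cos \<beta>)"

definition X0 :: "real \<Rightarrow> real \<Rightarrow> real \<Rightarrow> real" where
  "X0 a r \<beta> = (d1 a r \<beta>)^2 * Y0 a r \<beta>"

definition Bconst :: "real \<Rightarrow> real \<Rightarrow> real \<Rightarrow> real" where
  "Bconst a r \<beta> = 4 * a^3 * r * cos \<beta> * (sin \<beta>)^2 / (r - a * cos \<beta>)^2"

definition t_plus :: "real \<Rightarrow> real \<Rightarrow> real \<Rightarrow> real" where
  "t_plus a r \<beta> = ln (X0 a r \<beta> + sqrt (Bconst a r \<beta> * X0 a r \<beta> / Y0 a r \<beta>)) / 2"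

definition t_minus :: "real \<Rightarrow> real \<Rightarrow> real \<Rightarrow> real" where
  "t_minus a r \<beta> = ln (X0 a r \<beta> - sqrt (Bconst a r \<beta> * X0 a r \<beta> / Y0 a r \<beta>)) / 2"

definition s_plus :: "real \<Rightarrow> real \<Rightarrow> real \<Rightarrow> real" where
  "s_plus a r \<beta> = ln (Y0 a r \<beta> + sqrt (Bconst a r \<beta> * Y0 a r \<beta> / X0 a r \<beta>)) / 2"

definition s_minus :: "real \<Rightarrow> real \<Rightarrow> real \<Rightarrow> real" where
  "s_minus a r \<beta> = ln (Y0 a r \<beta> - sqrt (Bconst a r \<beta> * Y0 a r \<beta> / X0 a r \<beta>)) / 2"

text \<open>
  These are used only where the number is unique: \<open>s\<close> outside \<open>[s_minus, s_plus]\<close>, respectively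
  \<open>t\<close> outside \<open>[t_minus, t_plus]\<close>.
\<close>

definition t_crit :: "real \<Rightarrow> real \<Rightarrow> real \<Rightarrow> real \<Rightarrow> real" where
  "t_crit a r \<beta> s = (THE t. (t, s) \<in> Zset a r \<beta>)"

definition s_crit :: "real \<Rightarrow> real \<Rightarrow> real \<Rightarrow> real \<Rightarrow> real" where
  "s_crit a r \<beta> t = (THE s. (t, s) \<in> Zset a r \<beta>)"

end

theory Submission
  imports Defs
begin

text \<open>
  The hyperbolic cosine of the distance is elementary. In the given coordinates \<open>F = cosh \<phi>\<close> is a sum
  \<open>P + Q + U + V\<close> of positive multiples of \<open>e^(t+s)\<close>, \<open>e^(t-s)\<close>, \<open>e^(s-t)\<close>, \<open>e^(-s-t)\<close>, and the
  combination \<open>F F_st - F_s F_t\<close> is a constant \<open>\<kappa> = a cos \<beta> / r\<close>. Hence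
  \<open>\<phi>_st = N / (F^2 - 1)^(3/2)\<close> with \<open>N = (1 + \<kappa>) (Q + U) - (1 - \<kappa>) (P + V)\<close>
  (lemmas \<open>wronskian\<close> and \<open>\<phi>st_eq\<close>). Since \<open>F \<le> e^T\<close>, it remains to bound \<open>N\<close> from below.

  Away from the zero set: \<open>Q + U\<close> depends on \<open>(t, s)\<close> through \<open>t - s\<close> only, and \<open>P + V\<close> through
  \<open>t + s\<close> only, and each of these sums grows by a factor \<open>1 + \<epsilon>^2 / 2\<close> when its variable moves by
  \<open>\<epsilon>\<close> in a suitable direction. So the smaller one of the two terms of \<open>N\<close> can be raised to the level
  of the other one within distance \<open>\<epsilon>\<close>, unless \<open>|N|\<close> is at least of order \<open>\<epsilon>^2 (Q + U)\<close>
  (lemma \<open>zero_near\<close>). This argument is insensitive to the shape of the zero set, in particular to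
  how close the two branches of the hyperbola come to each other.

  In slices: for fixed \<open>s\<close>, \<open>N\<close> is \<open>A e^t - B e^(-t)\<close>, so that, if \<open>A B > 0\<close>, it has one zero
  \<open>t_c\<close> and \<open>|N| = 2 (A B)^(1/2) |sinh (t - t_c)|\<close> (lemma \<open>exp_difference_zero\<close>). If \<open>s\<close> is
  \<open>\<epsilon>\<close> away from \<open>[s_-, s_+]\<close>, then \<open>A\<close> and \<open>B\<close> are differences of terms whose ratio is at least
  \<open>e^(2 \<epsilon>)\<close>, and \<open>A B \<ge> \<epsilon>^2 (1 - \<kappa>)^2 P V\<close>, where \<open>P V\<close> is a constant \<open>\<ge> 1/16\<close>. Slices with
  \<open>t\<close> fixed behave in the same way.

  Both arguments need \<open>Q + U\<close> to be bounded below by a multiple of \<open>1 / F\<close>. This fails for segments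
  close to the axis, and it is here that \<open>\<alpha> \<notin> \<Gamma>_T\<close> enters: it keeps the segment of
  \<open>\<alpha> (\<gamma>)\<close> far from the whole line \<open>\<gamma>\<close>, which gives \<open>(P + Q) (U + V) \<ge> 2\<close>
  (lemmas \<open>far_outside_deck_tube\<close>, \<open>far_from_axisI\<close>, \<open>QU_bounded_below\<close>). For points near the zero
  set it follows moreover that \<open>1 - \<kappa>\<close> is at least of order \<open>1 / F^2\<close>.

  To get started one needs the distance formula for \<^const>\<open>hdist\<close> (lemma \<open>hdist_eq_arcosh\<close>): the
  Busemann functions of boundary points are 1-Lipschitz, and the geodesic semicircles attain the
  resulting bound. Non-coplanarity gives \<open>a \<noteq> 0\<close> (lemma \<open>coplanar_if_concentric\<close>); then the two
  geodesics are disjoint, so that \<open>F > 1\<close> and \<open>\<phi>\<close> is smooth everywhere.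
\<close>

section \<open>The distance of the upper half-space\<close>

text \<open>
  The Busemann function of the boundary point \<open>\<xi>\<close>, up to an additive constant. Its
  hyperbolic gradient has norm 1 everywhere, so it is 1-Lipschitz for the hyperbolic distance and,
  unlike the distance from a point, smooth on all of the half-space.
\<close>

definition busemann :: "real^3 \<Rightarrow> real^3 \<Rightarrow> real" where
  "busemann \<xi> x = ln ((x - \<xi>) \<bullet> (x - \<xi>)) - ln (x $ 3)"

lemma norm_busemann_gradient:
  fixes w :: "real^3"
  assumes "w $ 3 > 0"
  shows "norm ((2 / (w \<bullet> w)) *\<^sub>R w - (1 / w $ 3) *\<^sub>R axis 3 1) = 1 / w $ 3"
proof -
  have w: "w \<bullet> w > 0" using assms by (metis inner_gt_zero_iff order_less_irrefl zero_index)
  have "((2 / (w \<bullet> w)) *\<^sub>R w - (1 / w $ 3) *\<^sub>R axis 3 1) \<bullet>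
        ((2 / (w \<bullet> w)) *\<^sub>R w - (1 / w $ 3) *\<^sub>R axis 3 1) = (1 / w $ 3)\<^sup>2"
    using w assms
    by (simp add: inner_diff_left inner_diff_right inner_axis inner_axis' inner_commute
        field_simps power2_eq_square)
  then show ?thesis
    using assms by (simp add: norm_eq_sqrt_inner)
qed


lemma hlength_integrable:
  assumes "c C1_differentiable_on {0..1}" "c ` {0..1} \<subseteq> H3"
  shows "(\<lambda>u. norm (vector_derivative c (at u)) / (c u $ 3)) integrable_on {0..1}"
proof (rule integrable_continuous_interval)
  have "continuous_on {0..1} c"
    using assms(1) by (auto simp: C1_differentiable_on_eq intro!: continuous_at_imp_continuous_on differentiable_imp_continuous_within)
  then have c: "continuous_on {0..1} (\<lambda>u. c u $ 3)" by (intro continuous_intros)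
  have z: "\<forall>u\<in>{0..1}. c u $ 3 \<noteq> 0" using assms(2) by (fastforce simp: H3_def)
  show "continuous_on {0..1} (\<lambda>u. norm (vector_derivative c (at u)) / (c u $ 3))"
    using assms c z by (intro continuous_intros c) (auto simp: C1_differentiable_on_eq)
qed

lemma hlength_nonneg:
  assumes "c C1_differentiable_on {0..1}" "c ` {0..1} \<subseteq> H3"
  shows "hlength c \<ge> 0"
  unfolding hlength_def
proof (rule integral_nonneg[OF hlength_integrable[OF assms]])
  fix u :: real assume "u \<in> {0..1}"
  then have "c u \<in> H3" using assms(2) by blast
  then show "0 \<le> norm (vector_derivative c (at u)) / c u $ 3" by (simp add: H3_def)
qed

lemma busemann_diff_le_hlength:
  assumes c: "c C1_differentiable_on {0..1}" "c ` {0..1} \<subseteq> H3" and \<xi>: "\<xi> $ 3 = 0"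
  shows "busemann \<xi> (c 1) - busemann \<xi> (c 0) \<le> hlength c"
proof -
  let ?D = "\<lambda>u. vector_derivative c (at u)"
  let ?E = "\<lambda>u. (2 / ((c u - \<xi>) \<bullet> (c u - \<xi>))) *\<^sub>R (c u - \<xi>) - (1 / c u $ 3) *\<^sub>R axis 3 1"
  have der: "((\<lambda>u. busemann \<xi> (c u)) has_vector_derivative (?D u \<bullet> ?E u)) (at u within {0..1})"
    if "u \<in> {0..1}" for u
  proof -
    have z: "c u $ 3 > 0" using c(2) that unfolding H3_def by blast
    have "(c - (\<lambda>_. \<xi>)) u \<noteq> 0" using z \<xi> by (auto simp: vec_eq_iff intro!: exI[of _ 3])
    then have w: "(c u - \<xi>) \<bullet> (c u - \<xi>) > 0" by simp
    have D: "(c has_vector_derivative ?D u) (at u)"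
      using c(1) that by (simp add: C1_differentiable_on_eq vector_derivative_works)
    have D3: "((\<lambda>u. c u $ 3) has_real_derivative ?D u $ 3) (at u)"
      using bounded_linear.has_vector_derivative[OF bounded_linear_vec_nth D]
      by (simp add: has_real_derivative_iff_has_vector_derivative)
    have w': "((\<lambda>u. c u - \<xi>) has_vector_derivative ?D u) (at u)"
      using D by (auto intro!: derivative_eq_intros)
    have D2: "((\<lambda>u. (c u - \<xi>) \<bullet> (c u - \<xi>)) has_real_derivative 2 * (?D u \<bullet> (c u - \<xi>))) (at u)"
      using bounded_bilinear.has_vector_derivative[OF bounded_bilinear_inner w' w']
      by (simp add: has_real_derivative_iff_has_vector_derivative inner_commute)
    have "((\<lambda>u. busemann \<xi> (c u)) has_real_derivative (?D u \<bullet> ?E u)) (at u)"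
      unfolding busemann_def
      by (rule DERIV_cong[OF DERIV_diff[OF DERIV_chain2[OF DERIV_ln[OF w] D2] DERIV_chain2[OF DERIV_ln[OF z] D3]]])
         (simp add: inner_diff_right inner_axis divide_inverse)
    then show ?thesis
      by (simp add: has_real_derivative_iff_has_vector_derivative has_vector_derivative_at_within)
  qed
  have "((\<lambda>u. ?D u \<bullet> ?E u) has_integral (busemann \<xi> (c 1) - busemann \<xi> (c 0))) {0..1}"
    by (intro fundamental_theorem_of_calculus der) auto
  moreover have "((\<lambda>u. norm (?D u) / (c u $ 3)) has_integral hlength c) {0..1}"
    unfolding hlength_def using hlength_integrable[OF c] by (rule integrable_integral)
  moreover have "?D u \<bullet> ?E u \<le> norm (?D u) / (c u $ 3)" if "u \<in> {0..1}" for u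
  proof -
    have "c u $ 3 > 0" using c(2) that unfolding H3_def by blast
    then have "norm (?E u) = 1 / c u $ 3"
      using norm_busemann_gradient[of "c u - \<xi>"] \<xi> by simp
    then show ?thesis using norm_cauchy_schwarz[of "?D u" "?E u"] by simp
  qed
  ultimately show ?thesis by (rule has_integral_le)
qed

lemma hdist_curve_exists:
  assumes "x \<in> H3" "y \<in> H3"
  shows "\<exists>c. c C1_differentiable_on {0..1} \<and> c ` {0..1} \<subseteq> H3 \<and> c 0 = x \<and> c 1 = y"
proof (intro exI[of _ "\<lambda>u. x + u *\<^sub>R (y - x)"] conjI)
  show "(\<lambda>u. x + u *\<^sub>R (y - x)) C1_differentiable_on {0..1}"
    unfolding C1_differentiable_on_def
    by (intro exI[of _ "\<lambda>_. y - x"]) (auto intro!: derivative_eq_intros)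
  show "(\<lambda>u. x + u *\<^sub>R (y - x)) ` {0..1} \<subseteq> H3"
  proof (clarsimp simp: H3_def)
    fix u :: real assume u: "0 \<le> u" "u \<le> 1"
    have "x $ 3 > 0" "y $ 3 > 0" using assms by (auto simp: H3_def)
    then have "(1 - u) * x $ 3 + u * y $ 3 > 0"
      using u by (cases "u = 0") (auto intro!: add_nonneg_pos)
    then show "0 < x $ 3 + u * (y $ 3 - x $ 3)" by (simp add: algebra_simps)
  qed
qed auto

lemma hdist_geI:
  assumes "x \<in> H3" "y \<in> H3"
    and "\<And>c. c C1_differentiable_on {0..1} \<Longrightarrow> c ` {0..1} \<subseteq> H3 \<Longrightarrow> c 0 = x \<Longrightarrow> c 1 = y
             \<Longrightarrow> L \<le> hlength c"
  shows "L \<le> hdist x y"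
  unfolding hdist_def using assms hdist_curve_exists[OF assms(1,2)]
  by (intro cInf_greatest) auto

lemma hdist_leI:
  assumes "c C1_differentiable_on {0..1}" "c ` {0..1} \<subseteq> H3" "c 0 = x" "c 1 = y"
  shows "hdist x y \<le> hlength c"
  unfolding hdist_def using assms
  by (intro cInf_lower bdd_belowI[of _ 0]) (auto intro: hlength_nonneg)

lemma hdist_nonneg:
  assumes "x \<in> H3" "y \<in> H3" shows "0 \<le> hdist x y"
  using assms by (intro hdist_geI hlength_nonneg)

lemma hdist_self:
  assumes "x \<in> H3" shows "hdist x x = 0"
proof (rule antisym)
  have "hdist x x \<le> hlength (\<lambda>_. x)" by (rule hdist_leI) (use assms in auto)
  also have "\<dots> = 0" by (simp add: hlength_def)
  finally show "hdist x x \<le> 0" .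
qed (simp add: assms hdist_nonneg)

text \<open>
  The geodesic with centre \<open>m\<close> and Euclidean radius \<open>\<rho>\<close> in the vertical plane of direction \<open>e\<close>,
  with unit hyperbolic speed; it tends to the boundary point \<open>m - \<rho> e\<close>.
\<close>

definition semicircle :: "real \<Rightarrow> real^3 \<Rightarrow> real^3 \<Rightarrow> real \<Rightarrow> real^3" where
  "semicircle \<rho> m e s = m - (\<rho> * tanh s) *\<^sub>R e + (\<rho> / cosh s) *\<^sub>R axis 3 1"

lemma semicircle_reverse: "semicircle \<rho> m (- e) (- s) = semicircle \<rho> m e s"
  by (simp add: semicircle_def)

context
  fixes \<rho> :: real and m e :: "real^3"
  assumes \<rho>: "\<rho> > 0" and m: "m $ 3 = 0" and e: "e \<bullet> e = 1" "e $ 3 = 0"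
begin

lemma semicircle_height: "semicircle \<rho> m e s $ 3 = \<rho> / cosh s"
  using m e by (simp add: semicircle_def axis_def)

lemma semicircle_in_H3: "semicircle \<rho> m e s \<in> H3"
  using \<rho> by (simp add: H3_def semicircle_height)

lemma hdist_semicircle_le:
  "hdist (semicircle \<rho> m e s) (semicircle \<rho> m e s') \<le> \<bar>s' - s\<bar>"
proof -
  let ?l = "\<lambda>u. s + u * (s' - s)"
  define V where "V x = - (\<rho> * (1 - (tanh x)\<^sup>2)) *\<^sub>R e - (\<rho> * sinh x / (cosh x)\<^sup>2) *\<^sub>R axis 3 1"
    for x :: real
  let ?c = "\<lambda>u. semicircle \<rho> m e (?l u)"
  have D: "(?c has_vector_derivative ((s' - s) *\<^sub>R V (?l u))) (at u)" for u
    unfolding semicircle_def V_def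
    by (rule derivative_eq_intros refl | simp)+ (simp_all add: algebra_simps power2_eq_square)
  have V: "norm (V x) = \<rho> / cosh x" for x
  proof -
    have c2: "(cosh x)\<^sup>2 > 0" "(sinh x)\<^sup>2 = (cosh x)\<^sup>2 - 1" by (auto simp: sinh_square_eq)
    have "V x \<bullet> V x = (\<rho> * (1 - (tanh x)\<^sup>2))\<^sup>2 + (\<rho> * sinh x / (cosh x)\<^sup>2)\<^sup>2"
      using e by (simp add: V_def inner_diff_left inner_diff_right inner_axis inner_axis' power2_eq_square algebra_simps)
    also have "\<dots> = \<rho>\<^sup>2 * ((1 - (sinh x)\<^sup>2 / (cosh x)\<^sup>2)\<^sup>2 + (sinh x)\<^sup>2 / ((cosh x)\<^sup>2)\<^sup>2)"
      by (simp add: tanh_def power_divide power_mult_distrib distrib_left)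
    also have "\<dots> = (\<rho> / cosh x)\<^sup>2"
      using c2(1) unfolding c2(2) by (simp add: field_simps power2_eq_square)
    finally show ?thesis using \<rho> by (simp add: norm_eq_sqrt_inner)
  qed
  have "hdist (semicircle \<rho> m e s) (semicircle \<rho> m e s') \<le> hlength ?c"
  proof (rule hdist_leI)
    show "?c C1_differentiable_on {0..1}"
      unfolding C1_differentiable_on_def
    proof (intro exI conjI ballI)
      show "continuous_on {0..1} (\<lambda>u. (s' - s) *\<^sub>R V (?l u))"
        unfolding V_def by (intro continuous_intros) auto
    qed (rule D)
  qed (auto simp: semicircle_in_H3)
  also have "\<dots> = integral {0..1} (\<lambda>u::real. \<bar>s' - s\<bar>)"
    unfolding hlength_def vector_derivative_at[OF D] using \<rho>
    by (simp add: V semicircle_height)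
  also have "\<dots> = \<bar>s' - s\<bar>" by simp
  finally show ?thesis .
qed

text \<open>
  Along a geodesic that ends at \<open>\<xi>\<close>, the Busemann function of \<open>\<xi>\<close> decreases at unit rate, so the
  length of the geodesic equals the Lipschitz lower bound.
\<close>

lemma busemann_semicircle: "busemann (m - \<rho> *\<^sub>R e) (semicircle \<rho> m e s) = ln (2 * \<rho>) - s"
proof -
  define w where "w = semicircle \<rho> m e s - (m - \<rho> *\<^sub>R e)"
  have w: "w = (\<rho> * (1 - tanh s)) *\<^sub>R e + (\<rho> / cosh s) *\<^sub>R axis 3 1"
    by (simp add: w_def semicircle_def algebra_simps)
  have "w \<bullet> w = (\<rho> * (1 - tanh s))\<^sup>2 + (\<rho> / cosh s)\<^sup>2"
    using e by (simp add: w inner_add_left inner_add_right inner_axis inner_axis' power2_eq_square)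
  also have "\<dots> = \<rho>\<^sup>2 * ((cosh s - sinh s)\<^sup>2 + 1) / (cosh s)\<^sup>2"
  proof -
    have "1 - tanh s = (cosh s - sinh s) / cosh s" by (simp add: tanh_def diff_divide_distrib)
    then show ?thesis by (simp add: power_mult_distrib power_divide add_divide_distrib distrib_left)
  qed
  also have "(cosh s - sinh s)\<^sup>2 + 1 = 2 * cosh s * (cosh s - sinh s)"
    using hyperbolic_pythagoras[of s] by (simp add: power2_eq_square algebra_simps)
  also have "\<rho>\<^sup>2 * (2 * cosh s * (cosh s - sinh s)) / (cosh s)\<^sup>2 = (2 * \<rho> * exp (- s)) * (\<rho> / cosh s)"
    by (simp add: cosh_minus_sinh power2_eq_square)
  finally have "ln (w \<bullet> w) = ln (2 * \<rho> * exp (- s)) + ln (\<rho> / cosh s)"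
    using \<rho> by (simp only: ln_mult_pos) (subst ln_mult_pos, auto)
  then show ?thesis
    using \<rho> by (simp add: busemann_def w_def[symmetric] semicircle_height ln_mult_pos)
qed

end

lemma hdist_semicircle:
  assumes \<rho>: "\<rho> > 0" and m: "m $ 3 = 0" and e: "e \<bullet> e = 1" "e $ 3 = 0"
  shows "hdist (semicircle \<rho> m e s) (semicircle \<rho> m e s') = \<bar>s' - s\<bar>"
proof (rule antisym)
  have 1: "s - s' \<le> hdist (semicircle \<rho> m e s) (semicircle \<rho> m e s')"
    if e: "e \<bullet> e = 1" "e $ 3 = 0" for e s s'
  proof (rule hdist_geI)
    fix c assume c: "c C1_differentiable_on {0..1}" "c ` {0..1} \<subseteq> H3"
      "c 0 = semicircle \<rho> m e s" "c 1 = semicircle \<rho> m e s'"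
    show "s - s' \<le> hlength c"
      using busemann_diff_le_hlength[OF c(1,2), of "m - \<rho> *\<^sub>R e"] m e c
      by (simp add: busemann_semicircle[OF \<rho> m e])
  qed (use semicircle_in_H3[OF \<rho> m e] in auto)
  show "\<bar>s' - s\<bar> \<le> hdist (semicircle \<rho> m e s) (semicircle \<rho> m e s')"
    using 1[OF e, of s s'] 1[of "- e" "- s" "- s'"] e by (simp add: semicircle_reverse abs_le_iff)
qed (rule hdist_semicircle_le[OF assms])

text \<open>
  Two points on different verticals lie on a unique semicircle. With \<open>l\<close> the Euclidean distance of
  their projections to the boundary, the condition that the centre is equidistant from both points
  determines its position \<open>k\<close> on the line through the projections.
\<close>

lemma hdist_eq_arcosh:
  assumes "p \<in> H3" "q \<in> H3" "p $ 1 \<noteq> q $ 1 \<or> p $ 2 \<noteq> q $ 2"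
  shows "hdist p q = arcosh (((p $ 1 - q $ 1)\<^sup>2 + (p $ 2 - q $ 2)\<^sup>2 + (p $ 3)\<^sup>2 + (q $ 3)\<^sup>2) / (2 * p $ 3 * q $ 3))"
proof -
  define w where "w = (vector [q $ 1 - p $ 1, q $ 2 - p $ 2, 0] :: real^3)"
  define l where "l = norm w"
  define e where "e = (1 / l) *\<^sub>R w"
  define k where "k = (l\<^sup>2 + (q $ 3)\<^sup>2 - (p $ 3)\<^sup>2) / (2 * l)"
  define m where "m = p - (p $ 3) *\<^sub>R axis 3 1 + k *\<^sub>R e"
  define \<rho> where "\<rho> = sqrt (k\<^sup>2 + (p $ 3)\<^sup>2)"
  have z: "p $ 3 > 0" "q $ 3 > 0" using assms by (auto simp: H3_def)
  have l2: "l\<^sup>2 = (p $ 1 - q $ 1)\<^sup>2 + (p $ 2 - q $ 2)\<^sup>2"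
    by (simp add: l_def power2_norm_eq_inner w_def inner_vec_def sum_3 vector_3)
       (simp add: power2_eq_square algebra_simps)
  have l: "l > 0"
  proof -
    have "l\<^sup>2 > 0" unfolding l2 using assms(3)
      by (metis add_nonneg_pos add_pos_nonneg eq_iff_diff_eq_0 zero_le_power2 zero_less_power2)
    then show ?thesis by (simp add: l_def)
  qed
  have \<rho>: "\<rho> > 0" using z by (simp add: \<rho>_def add_nonneg_pos)
  have \<rho>2: "\<rho>\<^sup>2 = k\<^sup>2 + (p $ 3)\<^sup>2" by (simp add: \<rho>_def)
  have \<rho>2': "\<rho>\<^sup>2 = (l - k)\<^sup>2 + (q $ 3)\<^sup>2"
    unfolding \<rho>2 k_def using l by (simp add: field_simps power2_eq_square)
  have e: "e \<bullet> e = 1" "e $ 3 = 0"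
    using l by (auto simp: e_def l_def w_def vector_3 dot_square_norm power2_eq_square)
  have m: "m $ 3 = 0" by (simp add: m_def e axis_def)
  have on_circle: "semicircle \<rho> m e (arsinh (x / h)) = m - x *\<^sub>R e + h *\<^sub>R axis 3 1"
    "cosh (arsinh (x / h)) = \<rho> / h" if "\<rho>\<^sup>2 = x\<^sup>2 + h\<^sup>2" "h > 0" for x h
  proof -
    have "(cosh (arsinh (x / h)))\<^sup>2 = (\<rho> / h)\<^sup>2"
      using that by (simp add: cosh_square_eq power_divide field_simps)
    then show c: "cosh (arsinh (x / h)) = \<rho> / h"
      using \<rho> that by (simp add: power2_eq_iff_nonneg)
    then show "semicircle \<rho> m e (arsinh (x / h)) = m - x *\<^sub>R e + h *\<^sub>R axis 3 1"
      using \<rho> that by (simp add: semicircle_def tanh_def)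
  qed
  define s where "s = arsinh (k / p $ 3)"
  define s' where "s' = arsinh ((k - l) / q $ 3)"
  have \<rho>2'': "\<rho>\<^sup>2 = (k - l)\<^sup>2 + (q $ 3)\<^sup>2" using \<rho>2' by (simp add: power2_commute)
  have p: "semicircle \<rho> m e s = p"
    unfolding s_def on_circle(1)[OF \<rho>2 z(1)] by (simp add: m_def)
  have "w = l *\<^sub>R e" using l by (simp add: e_def)
  moreover have "q = p - (p $ 3) *\<^sub>R axis 3 1 + w + (q $ 3) *\<^sub>R axis 3 1"
    by (simp add: vec_eq_iff forall_3 w_def vector_3 axis_def)
  ultimately have q: "semicircle \<rho> m e s' = q"
    unfolding s'_def on_circle(1)[OF \<rho>2'' z(2)] by (simp add: m_def algebra_simps)
  have "hdist p q = \<bar>s' - s\<bar>"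
    using hdist_semicircle[OF \<rho> m e, of s s'] by (simp add: p q)
  also have "\<dots> = arcosh (cosh (s' - s))"
    by (metis abs_ge_zero arcosh_cosh_real cosh_real_abs)
  also have "cosh (s' - s) = (\<rho>\<^sup>2 - (k - l) * k) / (p $ 3 * q $ 3)"
    unfolding cosh_diff s_def s'_def on_circle(2)[OF \<rho>2 z(1)] on_circle(2)[OF \<rho>2'' z(2)]
    using z by (simp add: field_simps power2_eq_square)
  also have "\<rho>\<^sup>2 - (k - l) * k = (l\<^sup>2 + (p $ 3)\<^sup>2 + (q $ 3)\<^sup>2) / 2"
    unfolding \<rho>2 k_def using l by (simp add: field_simps power2_eq_square)
  finally show ?thesis by (simp add: l2 mult.assoc)
qed

section \<open>Concentric geodesics are coplanar\<close>

text \<open>Rotation about the vertical axis, as an isometry of the half-space.\<close>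

definition rotation :: "real \<Rightarrow> real^3 \<Rightarrow> real^3" where
  "rotation \<beta> p = vector [cos \<beta> * p $ 1 - sin \<beta> * p $ 2, sin \<beta> * p $ 1 + cos \<beta> * p $ 2, p $ 3]"

lemma rotation_height [simp]: "rotation \<beta> p $ 3 = p $ 3"
  by (simp add: rotation_def vector_3)

lemma rotation_inverse: "rotation (- \<beta>) (rotation \<beta> p) = p"
proof -
  have "cos \<beta> * (cos \<beta> * x) + sin \<beta> * (sin \<beta> * x) = x" for x
    using sin_cos_squared_add3[of \<beta>] by (metis mult.assoc distrib_right mult_1)
  from this[of "p $ 1"] this[of "p $ 2"] show ?thesis
    by (simp add: rotation_def vec_eq_iff forall_3 vector_3 algebra_simps)
qed

lemma linear_rotation: "bounded_linear (rotation \<beta>)"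
  by (intro linear_conv_bounded_linear[THEN iffD1] linearI)
     (simp_all add: rotation_def vec_eq_iff forall_3 vector_3 algebra_simps)

lemma norm_rotation: "norm (rotation \<beta> p) = norm p"
proof -
  have *: "x * (cos \<beta> * (cos \<beta> * y)) + x * (sin \<beta> * (sin \<beta> * y)) = x * y" for x y
    using sin_cos_squared_add3[of \<beta>] by (metis mult.assoc distrib_right distrib_left mult_1)
  have "rotation \<beta> p \<bullet> rotation \<beta> p = p \<bullet> p"
    using *[of "p$1" "p$1"] *[of "p$2" "p$2"]
    by (simp add: rotation_def inner_vec_def sum_3 vector_3 algebra_simps)
  then show ?thesis by (simp add: norm_eq_sqrt_inner)
qed

lemma hdist_rotation_le:
  assumes "x \<in> H3" "y \<in> H3"
  shows "hdist (rotation \<beta> x) (rotation \<beta> y) \<le> hdist x y"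
proof (rule hdist_geI[OF assms])
  fix c assume c: "c C1_differentiable_on {0..1}" "c ` {0..1} \<subseteq> H3" "c 0 = x" "c 1 = y"
  obtain D where D: "\<And>u. u \<in> {0..1} \<Longrightarrow> (c has_vector_derivative D u) (at u)"
    "continuous_on {0..1} D"
    using c(1) unfolding C1_differentiable_on_def by blast
  have D': "((\<lambda>u. rotation \<beta> (c u)) has_vector_derivative rotation \<beta> (D u)) (at u)"
    if "u \<in> {0..1}" for u
    by (rule bounded_linear.has_vector_derivative[OF linear_rotation D(1)[OF that]])
  have "hdist (rotation \<beta> x) (rotation \<beta> y) \<le> hlength (\<lambda>u. rotation \<beta> (c u))"
  proof (rule hdist_leI)
    show "(\<lambda>u. rotation \<beta> (c u)) C1_differentiable_on {0..1}"
      unfolding C1_differentiable_on_def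
      by (intro exI[of _ "\<lambda>u. rotation \<beta> (D u)"] conjI ballI D'
          bounded_linear.continuous_on[OF linear_rotation D(2)])
    show "(\<lambda>u. rotation \<beta> (c u)) ` {0..1} \<subseteq> H3"
      using c(2) by (auto simp: H3_def)
  qed (simp_all add: c)
  also have "\<dots> = hlength c"
    unfolding hlength_def
    by (rule integral_cong)
       (simp add: vector_derivative_at[OF D'] vector_derivative_at[OF D(1)] norm_rotation)
  finally show "hdist (rotation \<beta> x) (rotation \<beta> y) \<le> hlength c" .
qed

lemma hisometry_rotation: "hisometry (rotation \<beta>)"
  unfolding hisometry_def
proof (intro conjI ballI)
  show "bij_betw (rotation \<beta>) H3 H3"
    by (rule bij_betw_byWitness[where f' = "rotation (- \<beta>)"])
       (use rotation_inverse[of "- \<beta>"] in \<open>auto simp: rotation_inverse H3_def\<close>)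
next
  fix x y assume xy: "x \<in> H3" "y \<in> H3"
  then have "rotation \<beta> x \<in> H3" "rotation \<beta> y \<in> H3" by (auto simp: H3_def)
  from hdist_rotation_le[OF this, of "- \<beta>"] hdist_rotation_le[OF xy, of \<beta>]
  show "hdist (rotation \<beta> x) (rotation \<beta> y) = hdist x y" by (simp add: rotation_inverse)
qed

lemma hisometry_inv_into:
  assumes "hisometry \<Psi>"
  shows "hisometry (inv_into H3 \<Psi>)"
  unfolding hisometry_def
proof (intro conjI ballI)
  have bij: "bij_betw \<Psi> H3 H3" using assms by (simp add: hisometry_def)
  then show bij': "bij_betw (inv_into H3 \<Psi>) H3 H3" by (rule bij_betw_inv_into)
  fix x y assume xy: "x \<in> H3" "y \<in> H3"
  then have "inv_into H3 \<Psi> x \<in> H3" "inv_into H3 \<Psi> y \<in> H3"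
    using bij_betwE[OF bij'] by auto
  then have "hdist (\<Psi> (inv_into H3 \<Psi> x)) (\<Psi> (inv_into H3 \<Psi> y))
      = hdist (inv_into H3 \<Psi> x) (inv_into H3 \<Psi> y)"
    using assms by (simp add: hisometry_def)
  then show "hdist (inv_into H3 \<Psi> x) (inv_into H3 \<Psi> y) = hdist x y"
    using xy by (simp add: bij_betw_inv_into_right[OF bij])
qed

lemma hisometry_comp:
  assumes "hisometry \<Psi>" "hisometry \<Phi>"
  shows "hisometry (\<Psi> \<circ> \<Phi>)"
  using assms unfolding hisometry_def by (auto intro: bij_betw_trans dest: bij_betwE)

text \<open>
  For \<open>a = 0\<close> the semicircle is centred at the foot of the axis, so both geodesics lie in the vertical
  plane obtained from \<open>y = 0\<close> by the rotation through \<open>\<beta>\<close>.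
\<close>

lemma coplanar_if_concentric:
  assumes \<Psi>: "hisometry \<Psi>" and c: "range c \<subseteq> H3" and d: "range d \<subseteq> H3"
    and \<gamma>1: "\<And>t. \<Psi> (c t) = \<gamma>1 t" and \<gamma>2: "range (\<lambda>s. \<Psi> (d s)) = range (\<gamma>2 0 r \<beta>)"
  shows "coplanar_sets (range c) (range d)"
proof -
  let ?V = "{p \<in> H3. p $ 2 = 0}"
  let ?\<Phi> = "inv_into H3 \<Psi> \<circ> rotation \<beta>"
  have inj: "inj_on \<Psi> H3" using \<Psi> by (simp add: hisometry_def bij_betw_def)
  have in_plane: "x \<in> ?\<Phi> ` ?V" if "x \<in> H3" "\<Psi> x = rotation \<beta> v" "v $ 2 = 0" for x v
  proof -
    have "\<Psi> x \<in> H3" using \<Psi> that(1) unfolding hisometry_def by (blast dest: bij_betwE)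
    then have "v \<in> ?V" using that by (simp add: H3_def)
    moreover have "?\<Phi> v = x" using that inj by (metis comp_apply inv_into_f_f)
    ultimately show ?thesis by blast
  qed
  have "hplane (?\<Phi> ` ?V)"
    unfolding hplane_def
    using hisometry_comp[OF hisometry_inv_into[OF \<Psi>] hisometry_rotation] by blast
  moreover have "range c \<subseteq> ?\<Phi> ` ?V"
  proof clarify
    fix t
    have "\<Psi> (c t) = rotation \<beta> (\<gamma>1 t)"
      by (simp add: \<gamma>1 \<gamma>1_def rotation_def vec_eq_iff forall_3 vector_3)
    then show "c t \<in> ?\<Phi> ` ?V"
      using c by (intro in_plane) (auto simp: \<gamma>1_def vector_3)
  qed
  moreover have "range d \<subseteq> ?\<Phi> ` ?V"
  proof clarify
    fix s
    obtain s' where s': "\<Psi> (d s) = \<gamma>2 0 r \<beta> s'" using \<gamma>2 by blast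
    let ?v = "vector [(1 - exp (2 * s')) / (1 + exp (2 * s')) * r, 0,
      2 * r * exp s' / (1 + exp (2 * s'))] :: real^3"
    have "\<Psi> (d s) = rotation \<beta> ?v"
      by (simp add: s' \<gamma>2_def rotation_def vec_eq_iff forall_3 vector_3)
    then show "d s \<in> ?\<Phi> ` ?V"
      using d by (intro in_plane[of _ ?v]) (auto simp: vector_3)
  qed
  ultimately show ?thesis unfolding coplanar_sets_def by blast
qed

section \<open>Inequalities for exponential sums\<close>

lemma sinh_ge_self:
  fixes x :: real assumes "x \<ge> 0" shows "x \<le> sinh x"
proof -
  have "sinh 0 - 0 \<le> sinh x - x"
    using assms
  proof (rule DERIV_nonneg_imp_nondecreasing)
    fix y :: real
    have "((\<lambda>x. sinh x - x) has_real_derivative cosh y - 1) (at y)"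
      by (auto intro!: derivative_eq_intros)
    then show "\<exists>d. ((\<lambda>x. sinh x - x) has_real_derivative d) (at y) \<and> d \<ge> 0"
      using cosh_real_ge_1[of y] by (intro exI[of _ "cosh y - 1"]) auto
  qed
  then show ?thesis by simp
qed

lemma abs_sinh_ge: "\<bar>x\<bar> \<le> \<bar>sinh x :: real\<bar>"
  using sinh_ge_self[of "\<bar>x\<bar>"] sinh_ge_self[of "- x"] sinh_ge_self[of x] by (cases "x \<ge> 0") auto

lemma cosh_ge_quadratic: "1 + x\<^sup>2 / 2 \<le> cosh (x :: real)"
proof -
  have "(x / 2)\<^sup>2 \<le> (sinh (x / 2))\<^sup>2" using abs_sinh_ge[of "x / 2"] by (rule abs_le_square_iff[THEN iffD1])
  then have "1 + x\<^sup>2 / 2 \<le> 1 + 2 * (sinh (x / 2))\<^sup>2" by (simp add: power_divide)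
  also have "\<dots> = cosh (2 * (x / 2))" unfolding cosh_double by (simp add: cosh_square_eq)
  finally show ?thesis by simp
qed

text \<open>
  The sum equals \<open>(A + B) cosh \<xi> + (A - B) sinh \<xi>\<close>, so the sign of \<open>\<xi>\<close> can be chosen to make the
  second term nonnegative.
\<close>

lemma exp_combination_grows:
  fixes A B \<epsilon> :: real
  assumes "A \<ge> 0" "B \<ge> 0" "\<epsilon> \<ge> 0"
  obtains \<xi> where "\<bar>\<xi>\<bar> = \<epsilon>" "(A + B) * (1 + \<epsilon>\<^sup>2 / 2) \<le> A * exp \<xi> + B * exp (- \<xi>)"
proof -
  define \<xi> where "\<xi> = (if A \<ge> B then \<epsilon> else - \<epsilon>)"
  have "(A + B) * (1 + \<epsilon>\<^sup>2 / 2) \<le> (A + B) * cosh \<xi>"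
    using assms cosh_ge_quadratic[of \<epsilon>] by (intro mult_left_mono) (auto simp: \<xi>_def)
  also have "\<dots> \<le> (A + B) * cosh \<xi> + (A - B) * sinh \<xi>"
    using assms by (auto simp: \<xi>_def mult_nonpos_nonneg)
  also have "\<dots> = A * (cosh \<xi> + sinh \<xi>) + B * (cosh \<xi> - sinh \<xi>)" by (simp add: algebra_simps)
  also have "\<dots> = A * exp \<xi> + B * exp (- \<xi>)"
    by (simp add: cosh_plus_sinh cosh_minus_sinh)
  finally show thesis using that[of \<xi>] assms by (simp add: \<xi>_def)
qed

text \<open>
  The function is a multiple of \<open>sinh\<close> of the distance to its zero \<open>y = ln (B / A) / 2\<close>, with factor
  \<open>2 (A B)^(1/2)\<close> up to sign.
\<close>

lemma exp_difference_zero: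
  fixes A B k :: real
  assumes k: "k > 0" "k\<^sup>2 \<le> A * B"
  defines "h \<equiv> \<lambda>x. A * exp x - B * exp (- x)"
  shows "2 * k * \<bar>x - (THE y. h y = 0)\<bar> \<le> \<bar>h x\<bar>"
proof -
  have AB: "A * B > 0" using k by (metis order_less_le_trans zero_less_power)
  then have nz: "A \<noteq> 0" "B \<noteq> 0" and BA: "B / A > 0" by (auto simp: zero_less_mult_iff zero_less_divide_iff)
  define y where "y = ln (B / A) / 2"
  have B: "B = A * exp (2 * y)" using BA nz by (simp add: y_def)
  have h: "h x = 2 * (A * exp y) * sinh (x - y)" for x
  proof -
    have "exp x = exp y * exp (x - y)" "exp (2 * y) * exp (- x) = exp y * exp (- (x - y))"
      by (simp_all flip: exp_add)
    then have "h x = A * (exp y * exp (x - y)) - A * (exp y * exp (- (x - y)))"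
      unfolding h_def B by (simp add: mult.assoc)
    then show ?thesis by (simp add: sinh_field_def algebra_simps)
  qed
  have "(THE y. h y = 0) = y"
    by (rule the_equality) (use nz in \<open>auto simp: h\<close>)
  moreover have "k \<le> \<bar>A * exp y\<bar>"
  proof -
    have "A * B = (A * exp y)\<^sup>2" unfolding B exp_double by (simp add: power2_eq_square)
    then show ?thesis using k by (metis abs_le_square_iff abs_of_pos)
  qed
  then have "(2 * k) * \<bar>x - y\<bar> \<le> (2 * \<bar>A * exp y\<bar>) * \<bar>sinh (x - y)\<bar>"
    using k abs_sinh_ge[of "x - y"] by (intro mult_mono) auto
  ultimately show ?thesis by (simp add: h abs_mult)
qed

lemma product_of_gaps:
  fixes x1 x2 y1 y2 \<epsilon> :: real
  assumes "0 < \<epsilon>" "\<epsilon> \<le> 1 / 2"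
    and "0 \<le> x1" "x1 * exp (2 * \<epsilon>) \<le> y1" and "0 \<le> x2" "x2 * exp (2 * \<epsilon>) \<le> y2"
  shows "\<epsilon>\<^sup>2 * (y1 * y2) \<le> (y1 - x1) * (y2 - x2)"
proof -
  have gap: "0 \<le> y \<and> \<epsilon> * y \<le> y - x" if "0 \<le> x" "x * exp (2 * \<epsilon>) \<le> y" for x y
  proof -
    have "x * (1 + 2 * \<epsilon>) \<le> x * exp (2 * \<epsilon>)"
      using that by (intro mult_left_mono) auto
    then have 1: "x * (1 + 2 * \<epsilon>) \<le> y" using that(2) by simp
    have "0 \<le> x * (1 + 2 * \<epsilon>)" using that(1) assms(1) by simp
    with 1 have y: "0 \<le> y" by linarith
    have "1 \<le> (1 - \<epsilon>) * (1 + 2 * \<epsilon>)" using assms by (simp add: algebra_simps)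
    then have "y \<le> (1 - \<epsilon>) * y * (1 + 2 * \<epsilon>)"
      using mult_left_mono[of 1 "(1 - \<epsilon>) * (1 + 2 * \<epsilon>)" y] y by (simp add: algebra_simps)
    with 1 have "x * (1 + 2 * \<epsilon>) \<le> (1 - \<epsilon>) * y * (1 + 2 * \<epsilon>)" by simp
    then have "x \<le> (1 - \<epsilon>) * y" using assms(1) by (simp add: mult_le_cancel_right)
    then show ?thesis using y by (simp add: algebra_simps)
  qed
  note g1 = gap[OF assms(3,4)] and g2 = gap[OF assms(5,6)]
  have "0 \<le> \<epsilon> * y1" "0 \<le> \<epsilon> * y2" using g1 g2 assms(1) by auto
  then have "(\<epsilon> * y1) * (\<epsilon> * y2) \<le> (y1 - x1) * (y2 - x2)"
    using g1 g2 by (intro mult_mono) linarith+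
  then show ?thesis by (simp add: power2_eq_square mult_ac)
qed

text \<open>
  The number in question is the ordinate of a point of the hyperbola \<open>(X - x) (Y - y) = B\<close>, with
  abscissa \<open>x - sqrt (B x / y)\<close>; the point is in the positive quadrant. When \<open>X\<close> decreases from there
  to 0, the ordinate on this branch increases to \<open>y - B / x\<close>.
\<close>

lemma branch_endpoints:
  fixes x y B :: real
  assumes "0 < x" "0 < y" "0 \<le> B" "B < x * y"
  shows "0 < y - sqrt (B * y / x)" "y - sqrt (B * y / x) \<le> y - B / x"
proof -
  have "B * y / x < y\<^sup>2" using assms by (simp add: field_simps power2_eq_square)
  then have "sqrt (B * y / x) < y" using assms by (simp add: real_less_lsqrt)
  then show "0 < y - sqrt (B * y / x)" by simp
  have "B * B \<le> B * (x * y)" using assms by (intro mult_left_mono) auto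
  then have "(B / x)\<^sup>2 \<le> B * y / x" using assms by (simp add: field_simps power2_eq_square)
  then show "y - sqrt (B * y / x) \<le> y - B / x" by (simp add: real_le_rsqrt)
qed

section \<open>The mixed derivative of the distance\<close>

text \<open>
  The condition \<open>a > 0\<close> makes \<open>\<gamma>1\<close> and \<open>\<gamma>2\<close> disjoint, so that the distance is smooth everywhere.
\<close>

locale geodesic_pair =
  fixes a r \<beta> :: real
  assumes a: "a > 0" and r: "r > 0" and \<beta>: "0 < \<beta>" "\<beta> \<le> pi / 2"
begin

text \<open>
  \<open>D1\<close> and \<open>D2\<close> are the squared Euclidean distances of the endpoints of \<open>\<gamma>2\<close> from the foot of \<open>\<gamma>1\<close>,
  for \<open>s \<rightarrow> \<infinity>\<close> and \<open>s \<rightarrow> -\<infinity>\<close>. The functions \<open>P\<close>, \<open>Q\<close>, \<open>U\<close>, \<open>V\<close> are the four terms of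
  \<open>F = cosh \<phi>\<close>, and \<open>N\<close> is the numerator of the mixed derivative of \<open>\<phi>\<close>.
\<close>

definition "\<kappa> = a * cos \<beta> / r"
definition "D1 = a\<^sup>2 + r\<^sup>2 - 2 * a * r * cos \<beta>"
definition "D2 = a\<^sup>2 + r\<^sup>2 + 2 * a * r * cos \<beta>"
definition "P t s = exp (t + s) / (4 * r)"
definition "Q t s = exp (t - s) / (4 * r)"
definition "U t s = D1 * exp (s - t) / (4 * r)"
definition "V t s = D2 * exp (- s - t) / (4 * r)"
definition "F t s = P t s + Q t s + U t s + V t s"
definition "N t s = (1 + \<kappa>) * (Q t s + U t s) - (1 - \<kappa>) * (P t s + V t s)"

lemma cos_nonneg: "0 \<le> cos \<beta>" using \<beta> by (intro cos_ge_zero) auto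
lemma sin_pos: "0 < sin \<beta>" using \<beta> pi_gt_zero by (intro sin_gt_zero) linarith+
lemma \<kappa>_nonneg: "0 \<le> \<kappa>" using a r cos_nonneg by (simp add: \<kappa>_def)

lemma D1_pos: "0 < D1"
proof -
  have "D1 = (a - r * cos \<beta>)\<^sup>2 + (r * sin \<beta>)\<^sup>2"
    by (simp add: D1_def power2_diff power_mult_distrib sin_squared_eq algebra_simps)
  moreover have "0 < (r * sin \<beta>)\<^sup>2" using r sin_pos by simp
  ultimately show ?thesis by (simp add: add_nonneg_pos)
qed

lemma D2_ge: "r\<^sup>2 \<le> D2" "D1 \<le> D2" and D2_pos: "0 < D2"
proof -
  have 0: "0 \<le> a * r * cos \<beta>" using a r cos_nonneg by simp
  then show "r\<^sup>2 \<le> D2" "D1 \<le> D2" by (auto simp: D1_def D2_def)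
  then show "0 < D2" using D1_pos by simp
qed

text \<open>
  This is the triangle inequality \<open>d2 \<le> d1 + 2 r\<close> for the endpoints of \<open>\<gamma>2\<close>, in squared form.
\<close>

lemma D2_le: "D2 \<le> 2 * D1 + 8 * r\<^sup>2"
proof -
  have "2 * D1 + 8 * r\<^sup>2 - D2 = (a - 3 * r * cos \<beta>)\<^sup>2 + (3 * r * sin \<beta>)\<^sup>2"
    by (simp add: D1_def D2_def power2_diff power_mult_distrib sin_squared_eq algebra_simps)
  then show ?thesis by (smt (verit) zero_le_power2)
qed

lemma PQUV_pos: "0 < P t s" "0 < Q t s" "0 < U t s" "0 < V t s"
  using r D1_pos D2_pos by (auto simp: P_def Q_def U_def V_def)

lemma \<gamma>_in_H3: "\<gamma>1 t \<in> H3" "\<gamma>2 a r \<beta> s \<in> H3"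
  using r by (auto simp: H3_def \<gamma>1_def \<gamma>2_def vector_3 add_pos_pos)

lemma off_axis: "\<gamma>2 a r \<beta> s $ 1 \<noteq> 0 \<or> \<gamma>2 a r \<beta> s $ 2 \<noteq> 0"
  using a r sin_pos by (auto simp: \<gamma>2_def vector_3)

lemma hdist_\<gamma>_commute: "hdist (\<gamma>2 a r \<beta> s) (\<gamma>1 t) = hdist (\<gamma>1 t) (\<gamma>2 a r \<beta> s)"
  using off_axis[of s]
  by (subst (1 2) hdist_eq_arcosh)
     (auto simp: \<gamma>_in_H3, auto simp: \<gamma>1_def vector_3 power2_commute algebra_simps)

text \<open>
  By \<open>tanh^2 + 1 / cosh^2 = 1\<close>, the squared Euclidean norm of \<open>\<gamma>2 s\<close> is affine in \<open>tanh s\<close>; multiplying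
  by \<open>cosh s\<close> turns the distance formula into four exponentials. Below, \<open>\<tau>\<close> is \<open>- tanh s\<close>.
\<close>

lemma \<phi>_eq: "\<phi> a r \<beta> t s = arcosh (F t s)" and F_gt_1: "F t s > 1"
proof -
  let ?x = "\<gamma>2 a r \<beta> s $ 1" and ?y = "\<gamma>2 a r \<beta> s $ 2" and ?z = "\<gamma>2 a r \<beta> s $ 3"
  have z: "?z > 0" using \<gamma>_in_H3 by (simp add: H3_def)
  define E where "E = exp s"
  define e where "e = exp t"
  have E: "E > 0" "e > 0" by (auto simp: E_def e_def)
  have Es: "1 + E\<^sup>2 > 0" using E by (simp add: add_pos_pos)
  have exps: "exp (2 * s) = E\<^sup>2" "exp (t + s) = e * E" "exp (t - s) = e / E" "exp (s - t) = E / e"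
    "exp (- s - t) = 1 / (E * e)"
    by (simp_all add: E_def e_def exp_add exp_diff exp_minus field_simps flip: exp_double)
  define \<tau> where "\<tau> = (1 - E\<^sup>2) / (1 + E\<^sup>2)"
  have x: "?x = a + \<tau> * r * cos \<beta>" and y: "?y = \<tau> * r * sin \<beta>" and z_eq: "?z = 2 * r * E / (1 + E\<^sup>2)"
    by (simp_all add: \<gamma>2_def vector_3 exps \<tau>_def E_def)
  have "\<tau>\<^sup>2 + (2 * E / (1 + E\<^sup>2))\<^sup>2 = 1"
    using Es unfolding \<tau>_def by (simp add: power_divide flip: add_divide_distrib) (simp add: power2_eq_square algebra_simps)
  then have "(2 * E / (1 + E\<^sup>2))\<^sup>2 = 1 - \<tau>\<^sup>2" by simp
  moreover have "?z = r * (2 * E / (1 + E\<^sup>2))" by (simp add: z_eq)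
  ultimately have "?z\<^sup>2 = r\<^sup>2 * (1 - \<tau>\<^sup>2)" by (metis power_mult_distrib)
  then have "?x\<^sup>2 + ?y\<^sup>2 + ?z\<^sup>2 = a\<^sup>2 + r\<^sup>2 + 2 * a * r * cos \<beta> * \<tau>"
    unfolding x y by (simp add: power2_sum power_mult_distrib sin_squared_eq algebra_simps)
  then have "(?x\<^sup>2 + ?y\<^sup>2 + e\<^sup>2 + ?z\<^sup>2) / (2 * e * ?z)
      = (a\<^sup>2 + r\<^sup>2 + 2 * a * r * cos \<beta> * \<tau> + e\<^sup>2) / (2 * e * ?z)"
    by (simp add: algebra_simps)
  also have "\<dots> = ((a\<^sup>2 + r\<^sup>2 + e\<^sup>2) * (1 + E\<^sup>2) + 2 * a * r * cos \<beta> * (1 - E\<^sup>2)) / (4 * r * E * e)"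
  proof -
    define W where "W = 1 + E\<^sup>2"
    have "W \<noteq> 0" using Es by (simp add: W_def)
    then show ?thesis
      using E r unfolding z_eq \<tau>_def W_def[symmetric] by (simp add: field_simps)
  qed
  also have "\<dots> = F t s"
    using E r unfolding F_def P_def Q_def U_def V_def D1_def D2_def exps
    by (simp add: field_simps power2_eq_square)
  finally have F: "F t s = (?x\<^sup>2 + ?y\<^sup>2 + e\<^sup>2 + ?z\<^sup>2) / (2 * e * ?z)" ..
  show "\<phi> a r \<beta> t s = arcosh (F t s)"
    unfolding \<phi>_def F using off_axis[of s]
    by (subst hdist_eq_arcosh) (auto simp: \<gamma>_in_H3, auto simp: \<gamma>1_def vector_3 e_def)
  have "0 < ?x\<^sup>2 + ?y\<^sup>2 + (e - ?z)\<^sup>2"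
    using off_axis[of s] by (metis add_pos_nonneg sum_power2_gt_zero_iff zero_le_power2)
  then have "2 * e * ?z < ?x\<^sup>2 + ?y\<^sup>2 + e\<^sup>2 + ?z\<^sup>2" by (simp add: power2_diff)
  then show "F t s > 1" unfolding F using z E by simp
qed

lemma F_derivs:
  "((\<lambda>t. F t s) has_real_derivative P t s + Q t s - U t s - V t s) (at t)"
  "((\<lambda>s. F t s) has_real_derivative P t s - Q t s + U t s - V t s) (at s)"
  "((\<lambda>s. P t s + Q t s - U t s - V t s) has_real_derivative P t s - Q t s - U t s + V t s) (at s)"
  using r unfolding F_def P_def Q_def U_def V_def
  by (auto intro!: derivative_eq_intros simp: field_simps)

text \<open>
  As \<open>P V\<close> and \<open>Q U\<close> are constant, so is \<open>F F_st - F_t F_s = 4 (P V - Q U)\<close>.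
\<close>

lemma wronskian:
  "F t s * (P t s - Q t s - U t s + V t s) - (P t s + Q t s - U t s - V t s) * (P t s - Q t s + U t s - V t s) = \<kappa>"
proof -
  have PV: "P t s * V t s = D2 / (16 * r\<^sup>2)" and QU: "Q t s * U t s = D1 / (16 * r\<^sup>2)"
    unfolding P_def Q_def U_def V_def by (simp_all add: power2_eq_square field_simps flip: exp_add)
  have "F t s * (P t s - Q t s - U t s + V t s) - (P t s + Q t s - U t s - V t s) * (P t s - Q t s + U t s - V t s)
      = 4 * (P t s * V t s - Q t s * U t s)"
    by (simp add: F_def algebra_simps)
  also have "\<dots> = \<kappa>"
    unfolding PV QU D1_def D2_def \<kappa>_def using r by (simp add: field_simps power2_eq_square)
  finally show ?thesis .
qed

text \<open>
  Differentiating \<open>arcosh F\<close> twice gives the numerator \<open>F_st (F^2 - 1) - F F_t F_s = \<kappa> F - F_st\<close>, which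
  is linear in the four exponentials.
\<close>

lemma \<phi>st_eq: "\<phi>st a r \<beta> t s = N t s / sqrt ((F t s)\<^sup>2 - 1) ^ 3"
proof -
  have F2: "(F t s)\<^sup>2 - 1 > 0" for t s using F_gt_1[of t s] by simp
  let ?Ft = "\<lambda>t s. P t s + Q t s - U t s - V t s"
  let ?Fs = "P t s - Q t s + U t s - V t s"
  let ?Fst = "P t s - Q t s - U t s + V t s"
  let ?S = "sqrt ((F t s)\<^sup>2 - 1)"
  have 1: "deriv (\<lambda>t. \<phi> a r \<beta> t s) t = ?Ft t s / sqrt ((F t s)\<^sup>2 - 1)" for t s
    unfolding \<phi>_eq
    by (rule DERIV_imp_deriv, rule DERIV_cong, rule DERIV_chain2[OF arcosh_real_has_field_derivative])
       (auto intro: F_gt_1 F_derivs)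
  have S: "?S > 0" using F2 by simp
  have "((\<lambda>s. sqrt ((F t s)\<^sup>2 - 1)) has_real_derivative F t s * ?Fs / ?S) (at s)"
    using F2[of t s]
    by (auto intro!: derivative_eq_intros F_derivs simp: field_simps)
  then have "((\<lambda>s. ?Ft t s / sqrt ((F t s)\<^sup>2 - 1)) has_real_derivative
      (?Fst * ?S - ?Ft t s * (F t s * ?Fs / ?S)) / (?S * ?S)) (at s)"
    using S by (intro DERIV_divide F_derivs) auto
  then have "\<phi>st a r \<beta> t s = (?Fst * ?S - ?Ft t s * (F t s * ?Fs / ?S)) / (?S * ?S)"
    unfolding \<phi>st_def 1 by (rule DERIV_imp_deriv)
  also have "\<dots> = (?Fst * ?S\<^sup>2 - ?Ft t s * F t s * ?Fs) / ?S ^ 3"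
    using S by (simp add: field_simps power2_eq_square power3_eq_cube)
  also have "?Fst * ?S\<^sup>2 - ?Ft t s * F t s * ?Fs = F t s * (F t s * ?Fst - ?Ft t s * ?Fs) - ?Fst"
    using F2[of t s] by (simp add: algebra_simps power2_eq_square)
  also have "\<dots> = N t s"
    unfolding wronskian by (simp add: F_def N_def algebra_simps)
  finally show ?thesis .
qed

lemma Zset_eq: "Zset a r \<beta> = {(t, s). N t s = 0}"
  using F_gt_1 by (auto simp: Zset_def \<phi>st_eq) (smt (verit) one_less_power pos2)

lemma \<phi>st_ge: "\<bar>N t s\<bar> / F t s ^ 3 \<le> \<bar>\<phi>st a r \<beta> t s\<bar>"
proof -
  have F: "F t s > 1" by (rule F_gt_1)
  then have S: "sqrt ((F t s)\<^sup>2 - 1) > 0" by simp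
  have "sqrt ((F t s)\<^sup>2 - 1) \<le> F t s" using F by (intro real_le_lsqrt) auto
  then have "sqrt ((F t s)\<^sup>2 - 1) ^ 3 \<le> F t s ^ 3" using S by (intro power_mono) auto
  then show ?thesis
    using S F by (simp add: \<phi>st_eq abs_mult power_abs) (intro divide_left_mono, auto)
qed

section \<open>Distance from the axis\<close>

lemma sum_le_F: "P t s + Q t s \<le> F t s" "U t s + V t s \<le> F t s"
  using PQUV_pos[of t s] by (auto simp: F_def)

text \<open>
  The minimum of \<open>F t s\<close> over all real \<open>t\<close> is \<open>2 sqrt ((P + Q) (U + V))\<close>, where the product does not
  depend on \<open>t\<close>. So this says that \<open>\<gamma>2 s\<close> has a certain distance from the whole geodesic \<open>\<gamma>1\<close>.
\<close>

definition "far_from_axis s \<longleftrightarrow> (\<forall>t. 2 \<le> (P t s + Q t s) * (U t s + V t s))"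

lemma far_from_axisI:
  assumes "\<And>t. 3 \<le> F t s"
  shows "far_from_axis s"
proof -
  define A where "A = P 0 s + Q 0 s"
  define B where "B = U 0 s + V 0 s"
  have AB: "A > 0" "B > 0" using PQUV_pos by (auto simp: A_def B_def add_pos_pos)
  have eqs: "P t s + Q t s = A * exp t" "U t s + V t s = B * exp (- t)" for t
    by (simp_all add: A_def B_def P_def Q_def U_def V_def exp_add exp_diff exp_minus field_simps)
  have prod: "(P t s + Q t s) * (U t s + V t s) = A * B" for t
    unfolding eqs by (simp add: exp_minus field_simps)
  (* the foot of the perpendicular from the point to the axis *)
  define t where "t = ln (B / A) / 2"
  have "(exp t)\<^sup>2 = B / A" using AB by (simp add: t_def flip: exp_double)
  then have "A * exp t = B * exp (- t)" using AB by (simp add: exp_minus field_simps power2_eq_square)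
  moreover have "3 \<le> A * exp t + B * exp (- t)" using assms[of t] eqs[of t] by (simp add: F_def)
  ultimately have "3 / 2 \<le> A * exp t" "3 / 2 \<le> B * exp (- t)" by auto
  then have "(3 / 2) * (3 / 2) \<le> (A * exp t) * (B * exp (- t))" by (intro mult_mono) auto
  also have "\<dots> = A * B" by (simp add: exp_minus)
  finally show ?thesis unfolding far_from_axis_def prod by simp
qed

text \<open>
  Ratios of the four terms that depend on one variable only; they locate the sign changes of the
  coefficients of the slices.
\<close>

lemma exchange: "P t s = Q t s * exp (2 * s)" "U t s * D2 = V t s * D1 * exp (2 * s)"
  "P t s * D1 = U t s * exp (2 * t)" "Q t s * D2 = V t s * exp (2 * t)"
  by (simp_all add: P_def Q_def U_def V_def field_simps flip: exp_add)

lemma PV_ge: "1 / 16 \<le> P t s * V t s"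
proof -
  have "P t s * V t s = D2 / (16 * r\<^sup>2)"
    using r by (simp add: P_def V_def field_simps power2_eq_square flip: exp_add)
  moreover have "1 / 16 \<le> D2 / (16 * r\<^sup>2)" using r D2_ge by (simp add: field_simps)
  ultimately show ?thesis by simp
qed

text \<open>
  By the triangle inequality for the endpoints, \<open>V\<close> is at most \<open>2 U\<close> plus a term whose product with
  \<open>P + Q\<close> is at most 1 on the half \<open>s \<ge> 0\<close> of the semicircle. So \<open>(P + Q) (U + V) \<ge> 2\<close> leaves at least
  1 for \<open>(P + Q) (3 U)\<close>.
\<close>

lemma U_bounded_below:
  assumes far: "far_from_axis s" and s: "0 \<le> s"
  shows "1 \<le> 3 * F t s * U t s"
proof -
  note pos = PQUV_pos[of t s]
  have far: "2 \<le> (P t s + Q t s) * (U t s + V t s)" using far by (simp add: far_from_axis_def)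
  have "V t s \<le> (2 * D1 + 8 * r\<^sup>2) * exp (- s - t) / (4 * r)"
    unfolding V_def using D2_le r by (intro divide_right_mono mult_right_mono) auto
  also have "\<dots> = 2 * (D1 * exp (- s - t) / (4 * r)) + 2 * r * exp (- s - t)"
    using r by (simp add: field_simps power2_eq_square)
  also have "D1 * exp (- s - t) / (4 * r) \<le> U t s"
    unfolding U_def using D1_pos r s by (intro divide_right_mono mult_left_mono) auto
  finally have V: "V t s \<le> 2 * U t s + 2 * r * exp (- s - t)" by simp
  have "(P t s + Q t s) * (2 * r * exp (- s - t)) = (exp (t + s) * exp (- s - t) + exp (t - s) * exp (- s - t)) / 2"
    using r by (simp add: P_def Q_def field_simps)
  also have "\<dots> = (1 + exp (- 2 * s)) / 2" by (simp flip: exp_add)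
  also have "\<dots> \<le> 1" using s by simp
  finally have 1: "(P t s + Q t s) * (2 * r * exp (- s - t)) \<le> 1" .
  have "(P t s + Q t s) * (U t s + V t s) \<le> (P t s + Q t s) * (3 * U t s + 2 * r * exp (- s - t))"
    using V pos by (intro mult_left_mono) auto
  also have "\<dots> \<le> (P t s + Q t s) * (3 * U t s) + 1" using 1 by (simp add: distrib_left)
  also have "\<dots> \<le> F t s * (3 * U t s) + 1"
    using sum_le_F[of t s] pos by (intro add_right_mono mult_right_mono) auto
  finally show ?thesis using far by simp
qed

lemma Q_bounded_below:
  assumes far: "far_from_axis s" and s: "s \<le> 0"
  shows "1 \<le> F t s * Q t s"
proof -
  note pos = PQUV_pos[of t s]
  have far: "2 \<le> (P t s + Q t s) * (U t s + V t s)" using far by (simp add: far_from_axis_def)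
  have "Q t s * exp (2 * s) \<le> Q t s * 1" using pos s by (intro mult_left_mono) auto
  then have "P t s \<le> Q t s" by (simp add: exchange(1)[of t s])
  then have "(P t s + Q t s) * (U t s + V t s) \<le> (2 * Q t s) * F t s"
    using pos sum_le_F[of t s] by (intro mult_mono) auto
  then show ?thesis using far by (simp add: algebra_simps)
qed

lemma QU_bounded_below:
  assumes far: "far_from_axis s"
  shows "1 \<le> 3 * F t s * (Q t s + U t s)"
proof -
  have pos: "0 < F t s * Q t s" "0 < F t s * U t s"
    using PQUV_pos[of t s] F_gt_1[of t s] by auto
  show ?thesis
    using pos U_bounded_below[OF far, of t] Q_bounded_below[OF far, of t]
    unfolding distrib_left mult.assoc by linarith
qed

text \<open>
  Each term changes by a factor of at most \<open>e\<close>. So the distance from the axis at one point of a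
  segment of unit length controls it on the whole segment.
\<close>

lemma F_Harnack:
  assumes "\<bar>s - s'\<bar> \<le> 1"
  shows "F t s' \<le> exp 1 * F t s"
proof -
  have "P t s' \<le> exp 1 * P t s" "Q t s' \<le> exp 1 * Q t s" "U t s' \<le> exp 1 * U t s" "V t s' \<le> exp 1 * V t s"
  proof -
    have E: "exp x \<le> exp 1 * exp y" if "x \<le> 1 + y" for x y :: real
      using that by (simp flip: exp_add)
    have E': "k * exp x / (4 * r) \<le> exp 1 * (k * exp y / (4 * r))" if "x \<le> 1 + y" "0 < k" for k x y
      using mult_left_mono[OF E[OF that(1)], of k] that(2) r by (simp add: divide_simps mult_ac)
    show "P t s' \<le> exp 1 * P t s" "Q t s' \<le> exp 1 * Q t s" "U t s' \<le> exp 1 * U t s" "V t s' \<le> exp 1 * V t s"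
      using E'[of "t + s'" "t + s" 1] E'[of "t - s'" "t - s" 1] E'[of "s' - t" "s - t" D1]
        E'[of "- s' - t" "- s - t" D2] assms D1_pos D2_pos
      by (simp_all add: P_def Q_def U_def V_def abs_le_iff)
  qed
  then show ?thesis by (simp add: F_def distrib_left)
qed

section \<open>Zeros near points where the numerator is small\<close>

lemma N_shift:
  "N (t + x) (s + y) = (1 + \<kappa>) * (Q t s * exp (x - y) + U t s * exp (- (x - y)))
     - (1 - \<kappa>) * (P t s * exp (x + y) + V t s * exp (- (x + y)))"
proof -
  have "P (t + x) (s + y) = P t s * exp (x + y)" "Q (t + x) (s + y) = Q t s * exp (x - y)"
    "U (t + x) (s + y) = U t s * exp (- (x - y))" "V (t + x) (s + y) = V t s * exp (- (x + y))"
    by (simp_all add: P_def Q_def U_def V_def mult.assoc algebra_simps flip: exp_add)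
  then show ?thesis by (simp add: N_def)
qed

text \<open>
  Moving along a diagonal keeps one of the two terms \<open>m\<close>, \<open>n\<close> of \<open>N = m - n\<close> fixed and can raise the
  other one by a factor \<open>1 + \<epsilon>^2 / 2\<close>. The smaller one is raised until it equals the larger one.
\<close>

lemma zero_near:
  assumes \<epsilon>: "0 < \<epsilon>" "\<epsilon> < 1" and small: "\<bar>N t s\<bar> < \<epsilon>\<^sup>2 / 4 * (Q t s + U t s)"
  obtains x y where "\<bar>x\<bar> \<le> \<epsilon> / 2" "\<bar>y\<bar> \<le> \<epsilon> / 2" "N (t + x) (s + y) = 0"
proof -
  note pos = PQUV_pos[of t s]
  define m where "m = (1 + \<kappa>) * (Q t s + U t s)"
  define n where "n = (1 - \<kappa>) * (P t s + V t s)"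
  have N: "N t s = m - n" by (simp add: N_def m_def n_def)
  have m: "Q t s + U t s \<le> m" unfolding m_def using \<kappa>_nonneg pos by (simp add: algebra_simps)
  have "\<epsilon>\<^sup>2 / 4 * (Q t s + U t s) \<le> \<epsilon>\<^sup>2 / 4 * m" using m by (intro mult_left_mono) auto
  then have Nm: "\<bar>m - n\<bar> < \<epsilon>\<^sup>2 / 4 * m" using small N by simp
  have m0: "m > 0" using m pos by simp
  have \<epsilon>2: "\<epsilon>\<^sup>2 < 1" using \<epsilon> by (simp add: power_less_one_iff)
  show thesis
  proof (cases "n \<le> m")
    case True
    (* n is comparable to m, hence 1 - \<kappa> > 0, and P + V can be used to raise n *)
    have "\<epsilon>\<^sup>2 / 4 * m \<le> 1 / 4 * m" using \<epsilon>2 m0 by (intro mult_right_mono) auto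
    then have n: "m / 2 < n" using Nm m0 by linarith
    then have "0 < n" using m0 by simp
    then have "0 < 1 - \<kappa>" unfolding n_def using pos by (simp add: zero_less_mult_iff)
    then obtain \<xi> where \<xi>: "\<bar>\<xi>\<bar> = \<epsilon>"
      "n * (1 + \<epsilon>\<^sup>2 / 2) \<le> (1 - \<kappa>) * P t s * exp \<xi> + (1 - \<kappa>) * V t s * exp (- \<xi>)"
      using exp_combination_grows[of "(1 - \<kappa>) * P t s" "(1 - \<kappa>) * V t s" \<epsilon>] pos \<epsilon>
      by (auto simp: n_def distrib_left)
    define f where "f u = N (t + u * \<xi> / 2) (s + u * \<xi> / 2)" for u
    have "\<epsilon>\<^sup>2 / 2 * (m / 2) \<le> \<epsilon>\<^sup>2 / 2 * n" using n by (intro mult_left_mono) auto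
    moreover have "m - n < \<epsilon>\<^sup>2 / 4 * m" using Nm by linarith
    ultimately have "m \<le> n * (1 + \<epsilon>\<^sup>2 / 2)" by (simp add: algebra_simps)
    then have "f 1 \<le> 0" using \<xi>(2) unfolding f_def N_shift by (simp add: m_def algebra_simps)
    moreover have "0 \<le> f 0" using True by (simp add: f_def N)
    moreover have "continuous_on {0..1} f" unfolding f_def N_shift by (intro continuous_intros) auto
    ultimately obtain u where u: "0 \<le> u" "u \<le> 1" "f u = 0" using IVT2'[of f 1 0 0] by auto
    have "\<bar>u * \<xi> / 2\<bar> \<le> \<epsilon> / 2"
      using u \<xi>(1) \<epsilon> by (simp add: abs_mult mult_left_le_one_le)
    with u(3) show thesis by (intro that) (auto simp: f_def)
  next
    case False
    obtain \<eta> where \<eta>: "\<bar>\<eta>\<bar> = \<epsilon>"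
      "m * (1 + \<epsilon>\<^sup>2 / 2) \<le> (1 + \<kappa>) * Q t s * exp \<eta> + (1 + \<kappa>) * U t s * exp (- \<eta>)"
      using exp_combination_grows[of "(1 + \<kappa>) * Q t s" "(1 + \<kappa>) * U t s" \<epsilon>] pos \<epsilon> \<kappa>_nonneg
      by (auto simp: m_def distrib_left)
    define f where "f u = N (t + u * \<eta> / 2) (s + - (u * \<eta> / 2))" for u
    have "0 \<le> \<epsilon>\<^sup>2 * m" using m0 by simp
    moreover have "n - m < \<epsilon>\<^sup>2 / 4 * m" using Nm by linarith
    ultimately have "n \<le> m * (1 + \<epsilon>\<^sup>2 / 2)" by (simp add: algebra_simps)
    then have "0 \<le> f 1" using \<eta>(2) unfolding f_def N_shift by (simp add: n_def algebra_simps)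
    moreover have "f 0 \<le> 0" using False by (simp add: f_def N)
    moreover have "continuous_on {0..1} f" unfolding f_def N_shift by (intro continuous_intros) auto
    ultimately obtain u where u: "0 \<le> u" "u \<le> 1" "f u = 0" using IVT'[of f 0 0 1] by auto
    have "\<bar>u * \<eta> / 2\<bar> \<le> \<epsilon> / 2"
      using u \<eta>(1) \<epsilon> by (simp add: abs_mult mult_left_le_one_le)
    with u(3) show thesis by (intro that[of "u * \<eta> / 2" "- (u * \<eta> / 2)"]) (auto simp: f_def)
  qed
qed

lemma N_ge_outside_Znbhd:
  assumes \<epsilon>: "0 < \<epsilon>" "\<epsilon> < 1" and far: "far_from_axis s" and out: "(t, s) \<notin> Znbhd a r \<beta> \<epsilon>"
  shows "\<epsilon>\<^sup>2 / (12 * F t s) \<le> \<bar>N t s\<bar>"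
proof (rule ccontr)
  assume "\<not> ?thesis"
  then have "\<bar>N t s\<bar> < \<epsilon>\<^sup>2 / 4 * (1 / (3 * F t s))" by simp
  also have "1 / (3 * F t s) \<le> Q t s + U t s"
    using QU_bounded_below[OF far, of t] F_gt_1[of t s] by (simp add: field_simps)
  then have "\<epsilon>\<^sup>2 / 4 * (1 / (3 * F t s)) \<le> \<epsilon>\<^sup>2 / 4 * (Q t s + U t s)" by (intro mult_left_mono) auto
  finally obtain x y where xy: "\<bar>x\<bar> \<le> \<epsilon> / 2" "\<bar>y\<bar> \<le> \<epsilon> / 2" "N (t + x) (s + y) = 0"
    using zero_near[OF \<epsilon>] by blast
  then have Z: "(t + x, s + y) \<in> Zset a r \<beta>" by (simp add: Zset_eq)
  have "infdist (t, s) (Zset a r \<beta>) \<le> dist (t, s) (t + x, s + y)" by (rule infdist_le[OF Z])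
  also have "\<dots> \<le> \<bar>x\<bar> + \<bar>y\<bar>"
    using sqrt_sum_squares_le_sum_abs[of x y] by (simp add: dist_Pair_Pair dist_real_def)
  also have "\<dots> \<le> \<epsilon>" using xy by simp
  finally show False using out Z by (auto simp: Znbhd_def)
qed

text \<open>
  At a zero of \<open>N\<close> the terms \<open>(1 + \<kappa>) (Q + U)\<close> and \<open>(1 - \<kappa>) (P + V)\<close> agree, and within distance
  \<open>2 \<epsilon>\<close> of it each of them changes by a factor of at most \<open>e^(1/4)\<close>. As \<open>P + V \<le> F\<close>, a lower bound for
  \<open>Q + U\<close> becomes one for \<open>1 - \<kappa>\<close>.
\<close>

lemma \<kappa>_gap_in_Znbhd:
  assumes \<epsilon>: "0 < \<epsilon>" "\<epsilon> < 1 / 16" and far: "far_from_axis s" and near: "(t, s) \<in> Znbhd a r \<beta> \<epsilon>"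
  shows "1 \<le> 6 * (F t s)\<^sup>2 * (1 - \<kappa>)"
proof -
  note pos = PQUV_pos[of t s]
  (* the infimum of the distances need not be attained a priori, hence the radius 2 \<epsilon> *)
  have ne: "Zset a r \<beta> \<noteq> {}" and "infdist (t, s) (Zset a r \<beta>) < 2 * \<epsilon>"
    using near \<epsilon> by (auto simp: Znbhd_def)
  then have "\<exists>z \<in> Zset a r \<beta>. dist (t, s) z < 2 * \<epsilon>"
    using \<epsilon> by (simp add: infdist_def cINF_less_iff)
  then obtain t' s' where Z: "N t' s' = 0" and d: "dist (t, s) (t', s') < 2 * \<epsilon>"
    by (auto simp: Zset_eq)
  define x where "x = t' - t"
  define y where "y = s' - s"
  have "\<bar>x\<bar> < 2 * \<epsilon>" "\<bar>y\<bar> < 2 * \<epsilon>"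
    using d dist_fst_le[of "(t, s)" "(t', s')"] dist_snd_le[of "(t, s)" "(t', s')"]
    by (auto simp: x_def y_def dist_real_def)
  then have xy: "\<bar>x - y\<bar> < 1 / 4" "\<bar>x + y\<bar> < 1 / 4" using \<epsilon> by linarith+
  have lo: "exp (- (1 / 4)) \<le> exp z" and hi: "exp z \<le> exp (1 / 4)" if "\<bar>z\<bar> < 1 / 4" for z :: real
    using that by auto
  have "N (t + x) (s + y) = 0" using Z by (simp add: x_def y_def)
  then have eq: "(1 + \<kappa>) * (Q t s * exp (x - y) + U t s * exp (- (x - y)))
     = (1 - \<kappa>) * (P t s * exp (x + y) + V t s * exp (- (x + y)))" by (simp add: N_shift)
  let ?X = "Q t s * exp (x - y) + U t s * exp (- (x - y))"
  have "(Q t s + U t s) * exp (- (1 / 4)) \<le> ?X"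
    unfolding distrib_right using pos xy
    by (intro add_mono mult_left_mono lo; linarith)
  also have "0 \<le> \<kappa> * ?X" using pos \<kappa>_nonneg by simp
  then have "?X \<le> (1 + \<kappa>) * ?X" by (simp add: distrib_right)
  finally have le: "(Q t s + U t s) * exp (- (1 / 4)) \<le> (1 - \<kappa>) * (P t s * exp (x + y) + V t s * exp (- (x + y)))"
    by (simp only: eq)
  have "0 < (Q t s + U t s) * exp (- (1 / 4))" using pos by simp
  with le have "0 < (1 - \<kappa>) * (P t s * exp (x + y) + V t s * exp (- (x + y)))" by linarith
  moreover have "0 < P t s * exp (x + y) + V t s * exp (- (x + y))" using pos by (simp add: add_pos_pos)
  ultimately have \<kappa>: "0 < 1 - \<kappa>" by (simp add: zero_less_mult_iff)
  note le
  also have "(1 - \<kappa>) * (P t s * exp (x + y) + V t s * exp (- (x + y))) \<le> (1 - \<kappa>) * ((P t s + V t s) * exp (1 / 4))"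
    unfolding distrib_right using pos xy \<kappa>
    by (intro mult_left_mono add_mono hi; linarith)
  also have "\<dots> \<le> (1 - \<kappa>) * (F t s * exp (1 / 4))"
    using pos \<kappa> by (intro mult_left_mono mult_right_mono) (auto simp: F_def)
  finally have "(Q t s + U t s) * exp (- (1 / 4)) * exp (1 / 4) \<le> (1 - \<kappa>) * (F t s * exp (1 / 4)) * exp (1 / 4)"
    by (rule mult_right_mono) simp
  then have "Q t s + U t s \<le> (1 - \<kappa>) * F t s * exp (1 / 2)"
    by (simp add: mult.assoc flip: exp_add)
  also have "\<dots> \<le> (1 - \<kappa>) * F t s * 2"
    using \<kappa> F_gt_1[of t s] exp_half_le2 by (intro mult_left_mono) auto
  finally have "3 * F t s * (Q t s + U t s) \<le> 3 * F t s * ((1 - \<kappa>) * F t s * 2)"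
    using F_gt_1[of t s] by (intro mult_left_mono) auto
  with QU_bounded_below[OF far, of t] show ?thesis
    by (simp add: power2_eq_square algebra_simps)
qed

section \<open>Slices outside the two branches\<close>

lemma t_crit_bound:
  assumes k: "0 < k" "k\<^sup>2 \<le> ((1 + \<kappa>) * Q t s - (1 - \<kappa>) * P t s) * ((1 - \<kappa>) * V t s - (1 + \<kappa>) * U t s)"
  shows "2 * k * \<bar>t - t_crit a r \<beta> s\<bar> \<le> \<bar>N t s\<bar>"
proof -
  define A where "A = ((1 + \<kappa>) * Q t s - (1 - \<kappa>) * P t s) * exp (- t)"
  define B where "B = ((1 - \<kappa>) * V t s - (1 + \<kappa>) * U t s) * exp t"
  have N: "N x s = A * exp x - B * exp (- x)" for x
    using N_shift[of t "x - t" s 0]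
    by (simp add: A_def B_def algebra_simps exp_diff exp_minus divide_inverse)
  have "A * B = ((1 + \<kappa>) * Q t s - (1 - \<kappa>) * P t s) * ((1 - \<kappa>) * V t s - (1 + \<kappa>) * U t s)"
    by (simp add: A_def B_def exp_minus)
  then show ?thesis
    using exp_difference_zero[of k A B t] k by (simp add: t_crit_def Zset_eq N)
qed

lemma s_crit_bound:
  assumes k: "0 < k" "k\<^sup>2 \<le> ((1 + \<kappa>) * U t s - (1 - \<kappa>) * P t s) * ((1 - \<kappa>) * V t s - (1 + \<kappa>) * Q t s)"
  shows "2 * k * \<bar>s - s_crit a r \<beta> t\<bar> \<le> \<bar>N t s\<bar>"
proof -
  define A where "A = ((1 + \<kappa>) * U t s - (1 - \<kappa>) * P t s) * exp (- s)"
  define B where "B = ((1 - \<kappa>) * V t s - (1 + \<kappa>) * Q t s) * exp s"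
  have N: "N t x = A * exp x - B * exp (- x)" for x
    using N_shift[of t 0 s "x - s"]
    by (simp add: A_def B_def algebra_simps exp_diff exp_minus divide_inverse)
  have "A * B = ((1 + \<kappa>) * U t s - (1 - \<kappa>) * P t s) * ((1 - \<kappa>) * V t s - (1 + \<kappa>) * Q t s)"
    by (simp add: A_def B_def exp_minus)
  then show ?thesis
    using exp_difference_zero[of k A B s] k by (simp add: s_crit_def Zset_eq N)
qed

lemma hyperbola_constants:
  assumes "\<kappa> < 1"
  shows "0 < Y0 a r \<beta>" "0 < X0 a r \<beta>" "(1 - \<kappa>) * Y0 a r \<beta> = 1 + \<kappa>" "X0 a r \<beta> = D1 * Y0 a r \<beta>"
    "Bconst a r \<beta> = X0 a r \<beta> * Y0 a r \<beta> - D2" "0 \<le> Bconst a r \<beta>"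
proof -
  have k: "0 < r - a * cos \<beta>" using assms r by (simp add: \<kappa>_def field_simps)
  have nonneg: "0 \<le> a * cos \<beta>" using a cos_nonneg by simp
  show Y0: "0 < Y0 a r \<beta>" unfolding Y0_def using k r nonneg by (intro divide_pos_pos) auto
  show X0: "X0 a r \<beta> = D1 * Y0 a r \<beta>" using D1_pos by (simp add: X0_def d1_def D1_def)
  then show "0 < X0 a r \<beta>" using D1_pos Y0 by simp
  show "(1 - \<kappa>) * Y0 a r \<beta> = 1 + \<kappa>" using k r by (simp add: Y0_def \<kappa>_def field_simps)
  have "4 * a ^ 3 * r * cos \<beta> * (sin \<beta>)\<^sup>2 = D1 * (r + a * cos \<beta>)\<^sup>2 - D2 * (r - a * cos \<beta>)\<^sup>2"
    unfolding D1_def D2_def sin_squared_eq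
    by (simp add: power2_eq_square power3_eq_cube algebra_simps)
  then have "Bconst a r \<beta> = (D1 * (r + a * cos \<beta>)\<^sup>2 - D2 * (r - a * cos \<beta>)\<^sup>2) / (r - a * cos \<beta>)\<^sup>2"
    by (simp add: Bconst_def)
  also have "\<dots> = X0 a r \<beta> * Y0 a r \<beta> - D2"
    using k by (simp add: X0 Y0_def diff_divide_distrib power_divide power2_eq_square)
  finally show "Bconst a r \<beta> = X0 a r \<beta> * Y0 a r \<beta> - D2" .
  show "0 \<le> Bconst a r \<beta>" using a r cos_nonneg by (simp add: Bconst_def)
qed

text \<open>
  The coefficients of the slice at \<open>s\<close> change sign at \<open>e^(2 s) = Y0\<close> and \<open>e^(2 s) = D2 / X0 = Y0 - B / X0\<close>.
  Both levels lie between \<open>e^(2 s_-)\<close> and \<open>e^(2 s_+)\<close>, so leaving \<open>[s_-, s_+]\<close> by \<open>\<epsilon>\<close> leaves a factor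
  \<open>e^(2 \<epsilon>)\<close> of room for both. The same holds for \<open>t\<close>, with \<open>X0\<close> and \<open>Y0\<close> interchanged.
\<close>

lemma branch_ends:
  assumes \<kappa>: "\<kappa> < 1"
  shows "s_plus a r \<beta> + \<epsilon> < s \<Longrightarrow> Y0 a r \<beta> * exp (2 * \<epsilon>) \<le> exp (2 * s)"
    and "s < s_minus a r \<beta> - \<epsilon> \<Longrightarrow> X0 a r \<beta> * exp (2 * s) * exp (2 * \<epsilon>) \<le> D2"
    and "t_plus a r \<beta> + \<epsilon> < t \<Longrightarrow> X0 a r \<beta> * exp (2 * \<epsilon>) \<le> exp (2 * t)"
    and "t < t_minus a r \<beta> - \<epsilon> \<Longrightarrow> Y0 a r \<beta> * exp (2 * t) * exp (2 * \<epsilon>) \<le> D2"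
proof -
  let ?X = "X0 a r \<beta>" and ?Y = "Y0 a r \<beta>" and ?B = "Bconst a r \<beta>"
  note h = hyperbola_constants[OF \<kappa>]
  have BXY: "?B < ?X * ?Y" using h(5) D2_pos by simp
  have plus: "y * exp (2 * \<epsilon>) \<le> exp (2 * x)"
    if "ln (y + q) / 2 + \<epsilon> < x" "0 < y" "0 \<le> q" for x y q :: real
  proof -
    have "y * exp (2 * \<epsilon>) \<le> (y + q) * exp (2 * \<epsilon>)" using that by simp
    also have "\<dots> = exp (2 * (ln (y + q) / 2 + \<epsilon>))" using that by (simp add: exp_add distrib_left)
    also have "\<dots> \<le> exp (2 * x)" using that by simp
    finally show ?thesis .
  qed
  have minus: "exp (2 * x) * exp (2 * \<epsilon>) \<le> y - q" if "x < ln (y - q) / 2 - \<epsilon>" "0 < y - q" for x y q :: real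
  proof -
    have "exp (2 * x) * exp (2 * \<epsilon>) = exp (2 * (x + \<epsilon>))" by (simp add: exp_add distrib_left)
    also have "\<dots> \<le> exp (2 * (ln (y - q) / 2))" using that(1) by simp
    also have "\<dots> = y - q" using that(2) by simp
    finally show ?thesis .
  qed
  show "s_plus a r \<beta> + \<epsilon> < s \<Longrightarrow> ?Y * exp (2 * \<epsilon>) \<le> exp (2 * s)"
    using plus[of ?Y "sqrt (?B * ?Y / ?X)" s] h(1,2,6) by (simp add: s_plus_def)
  show "t_plus a r \<beta> + \<epsilon> < t \<Longrightarrow> ?X * exp (2 * \<epsilon>) \<le> exp (2 * t)"
    using plus[of ?X "sqrt (?B * ?X / ?Y)" t] h(1,2,6) by (simp add: t_plus_def)
  show "?X * exp (2 * s) * exp (2 * \<epsilon>) \<le> D2" if "s < s_minus a r \<beta> - \<epsilon>"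
  proof -
    have "exp (2 * s) * exp (2 * \<epsilon>) \<le> ?Y - ?B / ?X"
      using minus[of s ?Y "sqrt (?B * ?Y / ?X)"] branch_endpoints[OF h(2,1,6) BXY] that
      by (simp add: s_minus_def)
    then show ?thesis using h(1,2) by (simp add: h(5) field_simps)
  qed
  show "?Y * exp (2 * t) * exp (2 * \<epsilon>) \<le> D2" if "t < t_minus a r \<beta> - \<epsilon>"
  proof -
    have "exp (2 * t) * exp (2 * \<epsilon>) \<le> ?X - ?B / ?Y"
      using minus[of t ?X "sqrt (?B * ?X / ?Y)"] branch_endpoints[OF h(1,2,6)] BXY that
      by (simp add: t_minus_def mult.commute)
    then show ?thesis using h(1,2) by (simp add: h(5) field_simps)
  qed
qed

text \<open>
  In each of the four regions outside the branches, the dominating terms of the two coefficients are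
  at least \<open>(1 - \<kappa>) P\<close> and \<open>(1 - \<kappa>) V\<close>. Thus the constant product \<open>P V\<close> serves for all of them, even
  where the other terms are not bounded below.
\<close>

lemma product_PV:
  assumes "\<kappa> < 1" "(1 - \<kappa>) * P t s \<le> y1" "(1 - \<kappa>) * V t s \<le> y2"
  shows "(\<epsilon> * (1 - \<kappa>) / 4)\<^sup>2 \<le> \<epsilon>\<^sup>2 * (y1 * y2)"
proof -
  have "(1 - \<kappa>)\<^sup>2 * (1 / 16) \<le> (1 - \<kappa>)\<^sup>2 * (P t s * V t s)"
    using PV_ge by (intro mult_left_mono) auto
  also have "\<dots> = ((1 - \<kappa>) * P t s) * ((1 - \<kappa>) * V t s)" by (simp add: power2_eq_square)
  also have "\<dots> \<le> y1 * y2"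
    using assms PQUV_pos[of t s] by (intro mult_mono) (auto intro: order_trans[rotated])
  finally have "\<epsilon>\<^sup>2 * ((1 - \<kappa>)\<^sup>2 * (1 / 16)) \<le> \<epsilon>\<^sup>2 * (y1 * y2)" by (rule mult_left_mono) simp
  then show ?thesis by (simp add: power_mult_distrib power_divide)
qed

text \<open>
  Above \<open>s_+\<close> the terms \<open>P\<close> and \<open>U\<close> dominate the coefficients of \<open>e^t\<close> and \<open>e^(-t)\<close>, below \<open>s_-\<close> the terms
  \<open>Q\<close> and \<open>V\<close> do. In both cases the coefficients have opposite signs, so that the slice has a simple zero.
\<close>

lemma N_ge_t_crit:
  assumes \<epsilon>: "0 < \<epsilon>" "\<epsilon> \<le> 1 / 2" and \<kappa>: "\<kappa> < 1"
    and s: "s_plus a r \<beta> + \<epsilon> < s \<or> s < s_minus a r \<beta> - \<epsilon>"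
  shows "\<epsilon> * (1 - \<kappa>) / 2 * \<bar>t - t_crit a r \<beta> s\<bar> \<le> \<bar>N t s\<bar>"
proof -
  let ?X = "X0 a r \<beta>" and ?Y = "Y0 a r \<beta>" and ?k = "\<epsilon> * (1 - \<kappa>) / 4"
  let ?P = "(1 - \<kappa>) * P t s" and ?Q = "(1 + \<kappa>) * Q t s"
  let ?U = "(1 + \<kappa>) * U t s" and ?V = "(1 - \<kappa>) * V t s"
  note h = hyperbola_constants[OF \<kappa>] and pos = PQUV_pos[of t s]
  have nn: "0 \<le> ?P" "0 \<le> ?Q" "0 \<le> ?U" "0 \<le> ?V" using pos \<kappa> \<kappa>_nonneg by auto
  have grow: "x \<le> x * exp (2 * \<epsilon>)" if "0 \<le> x" for x
    using that \<epsilon> mult_left_mono[of 1 "exp (2 * \<epsilon>)" x] by simp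
  have Q: "?Q = (1 - \<kappa>) * Q t s * ?Y" by (simp flip: h(3))
  have U: "?U * D2 = (1 - \<kappa>) * V t s * (?X * exp (2 * s))"
    unfolding mult.assoc exchange(2) h(4) by (simp flip: h(3))
  have "?k\<^sup>2 \<le> (?Q - ?P) * (?V - ?U)"
    using s
  proof
    assume "s_plus a r \<beta> + \<epsilon> < s"
    from branch_ends(1)[OF \<kappa> this] have Y: "?Y * exp (2 * \<epsilon>) \<le> exp (2 * s)" .
    have 1: "?Q * exp (2 * \<epsilon>) \<le> ?P"
      unfolding Q exchange(1) using mult_left_mono[OF Y, of "(1 - \<kappa>) * Q t s"] pos \<kappa>
      by (simp add: mult_ac)
    have "D2 * exp (2 * \<epsilon>) \<le> ?X * ?Y * exp (2 * \<epsilon>)" using h(5,6) by simp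
    also have "\<dots> \<le> ?X * exp (2 * s)" using mult_left_mono[OF Y, of ?X] h(2) by (simp add: mult_ac)
    finally have "?V * (D2 * exp (2 * \<epsilon>)) \<le> ?V * (?X * exp (2 * s))" using nn by (intro mult_left_mono) auto
    then have "?V * exp (2 * \<epsilon>) * D2 \<le> ?U * D2" unfolding U by (simp add: mult_ac)
    then have 2: "?V * exp (2 * \<epsilon>) \<le> ?U" using D2_pos by simp
    have "?k\<^sup>2 \<le> \<epsilon>\<^sup>2 * (?P * ?U)"
      using 2 grow nn by (intro product_PV \<kappa>) (auto intro: order_trans)
    also have "\<dots> \<le> (?P - ?Q) * (?U - ?V)" by (rule product_of_gaps[OF \<epsilon> nn(2) 1 nn(4) 2])
    finally show ?thesis by (simp add: algebra_simps)
  next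
    assume "s < s_minus a r \<beta> - \<epsilon>"
    from branch_ends(2)[OF \<kappa> this] have E: "?X * exp (2 * s) * exp (2 * \<epsilon>) \<le> D2" .
    also have "D2 \<le> ?X * ?Y" using h(5,6) by simp
    finally have Y: "exp (2 * s) * exp (2 * \<epsilon>) \<le> ?Y" using h(2) by (simp add: mult.assoc)
    have 1: "?P * exp (2 * \<epsilon>) \<le> ?Q"
      unfolding Q exchange(1) using mult_left_mono[OF Y, of "(1 - \<kappa>) * Q t s"] pos \<kappa>
      by (simp add: mult_ac)
    have "?U * exp (2 * \<epsilon>) * D2 = ?V * (?X * exp (2 * s) * exp (2 * \<epsilon>))"
      using U by (simp add: mult_ac)
    also have "\<dots> \<le> ?V * D2" using E nn by (intro mult_left_mono) auto
    finally have 2: "?U * exp (2 * \<epsilon>) \<le> ?V" using D2_pos by simp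
    have "?k\<^sup>2 \<le> \<epsilon>\<^sup>2 * (?Q * ?V)"
      using 1 grow nn by (intro product_PV \<kappa>) (auto intro: order_trans)
    also have "\<dots> \<le> (?Q - ?P) * (?V - ?U)" by (rule product_of_gaps[OF \<epsilon> nn(1) 1 nn(3) 2])
    finally show ?thesis .
  qed
  from t_crit_bound[OF _ this] \<epsilon> \<kappa> show ?thesis by simp
qed

text \<open>
  Here the dominating terms are \<open>P\<close>, \<open>Q\<close> above \<open>t_+\<close> and \<open>U\<close>, \<open>V\<close> below \<open>t_-\<close>.
\<close>

lemma N_ge_s_crit:
  assumes \<epsilon>: "0 < \<epsilon>" "\<epsilon> \<le> 1 / 2" and \<kappa>: "\<kappa> < 1"
    and t: "t_plus a r \<beta> + \<epsilon> < t \<or> t < t_minus a r \<beta> - \<epsilon>"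
  shows "\<epsilon> * (1 - \<kappa>) / 2 * \<bar>s - s_crit a r \<beta> t\<bar> \<le> \<bar>N t s\<bar>"
proof -
  let ?X = "X0 a r \<beta>" and ?Y = "Y0 a r \<beta>" and ?k = "\<epsilon> * (1 - \<kappa>) / 4"
  let ?P = "(1 - \<kappa>) * P t s" and ?Q = "(1 + \<kappa>) * Q t s"
  let ?U = "(1 + \<kappa>) * U t s" and ?V = "(1 - \<kappa>) * V t s"
  note h = hyperbola_constants[OF \<kappa>] and pos = PQUV_pos[of t s]
  have nn: "0 \<le> ?P" "0 \<le> ?Q" "0 \<le> ?U" "0 \<le> ?V" using pos \<kappa> \<kappa>_nonneg by auto
  have grow: "x \<le> x * exp (2 * \<epsilon>)" if "0 \<le> x" for x
    using that \<epsilon> mult_left_mono[of 1 "exp (2 * \<epsilon>)" x] by simp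
  have U: "?U * D1 = (1 - \<kappa>) * U t s * ?X" by (simp add: h(4) flip: h(3))
  have P: "?P * D1 = (1 - \<kappa>) * U t s * exp (2 * t)" by (simp add: exchange(3))
  have Q: "?Q * D2 = ?V * (?Y * exp (2 * t))"
    unfolding mult.assoc exchange(4) by (simp flip: h(3))
  have nU: "0 \<le> (1 - \<kappa>) * U t s" using pos \<kappa> by simp
  have "?k\<^sup>2 \<le> (?U - ?P) * (?V - ?Q)"
    using t
  proof
    assume "t_plus a r \<beta> + \<epsilon> < t"
    from branch_ends(3)[OF \<kappa> this] have X: "?X * exp (2 * \<epsilon>) \<le> exp (2 * t)" .
    have "?U * exp (2 * \<epsilon>) * D1 = (1 - \<kappa>) * U t s * (?X * exp (2 * \<epsilon>))"
      using U by (simp add: mult_ac)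
    also have "\<dots> \<le> ?P * D1" unfolding P by (rule mult_left_mono[OF X nU])
    finally have 1: "?U * exp (2 * \<epsilon>) \<le> ?P" using D1_pos by simp
    have "D2 * exp (2 * \<epsilon>) \<le> ?X * ?Y * exp (2 * \<epsilon>)" using h(5,6) by simp
    also have "\<dots> \<le> ?Y * exp (2 * t)" using mult_left_mono[OF X, of ?Y] h(1) by (simp add: mult_ac)
    finally have "?V * (D2 * exp (2 * \<epsilon>)) \<le> ?V * (?Y * exp (2 * t))" using nn by (intro mult_left_mono) auto
    then have "?V * exp (2 * \<epsilon>) * D2 \<le> ?Q * D2" unfolding Q by (simp add: mult_ac)
    then have 2: "?V * exp (2 * \<epsilon>) \<le> ?Q" using D2_pos by simp
    have "?k\<^sup>2 \<le> \<epsilon>\<^sup>2 * (?P * ?Q)"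
      using 2 grow nn by (intro product_PV \<kappa>) (auto intro: order_trans)
    also have "\<dots> \<le> (?P - ?U) * (?Q - ?V)" by (rule product_of_gaps[OF \<epsilon> nn(3) 1 nn(4) 2])
    finally show ?thesis by (simp add: algebra_simps)
  next
    assume "t < t_minus a r \<beta> - \<epsilon>"
    from branch_ends(4)[OF \<kappa> this] have E: "?Y * exp (2 * t) * exp (2 * \<epsilon>) \<le> D2" .
    also have "D2 \<le> ?Y * ?X" using h(5,6) by (simp add: mult.commute)
    finally have X: "exp (2 * t) * exp (2 * \<epsilon>) \<le> ?X" using h(1) by (simp add: mult.assoc)
    have "?P * exp (2 * \<epsilon>) * D1 = (1 - \<kappa>) * U t s * (exp (2 * t) * exp (2 * \<epsilon>))"
      using P by (simp add: mult_ac)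
    also have "\<dots> \<le> ?U * D1" unfolding U by (rule mult_left_mono[OF X nU])
    finally have 1: "?P * exp (2 * \<epsilon>) \<le> ?U" using D1_pos by simp
    have "?Q * exp (2 * \<epsilon>) * D2 = ?V * (?Y * exp (2 * t) * exp (2 * \<epsilon>))"
      using Q by (simp add: mult_ac)
    also have "\<dots> \<le> ?V * D2" using E nn by (intro mult_left_mono) auto
    finally have 2: "?Q * exp (2 * \<epsilon>) \<le> ?V" using D2_pos by simp
    have "?k\<^sup>2 \<le> \<epsilon>\<^sup>2 * (?U * ?V)"
      using 1 grow nn by (intro product_PV \<kappa>) (auto intro: order_trans)
    also have "\<dots> \<le> (?U - ?P) * (?V - ?Q)" by (rule product_of_gaps[OF \<epsilon> nn(1) 1 nn(2) 2])
    finally show ?thesis .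
  qed
  from s_crit_bound[OF _ this] \<epsilon> \<kappa> show ?thesis by simp
qed

lemma const_exp_bound:
  assumes "1 \<le> T" "F t s \<le> exp T" "n \<le> 5"
  shows "exp (- 9 * T) \<le> 1 / (12 * F t s ^ n)"
proof -
  have F: "1 < F t s" by (rule F_gt_1)
  have "(12::real) \<le> 2 ^ 4" by simp
  also have "2 \<le> exp T" using assms(1) exp_ge_add_one_self[of T] by linarith
  then have "(2::real) ^ 4 \<le> exp T ^ 4" by (rule power_mono) simp
  finally have 12: "12 \<le> exp T ^ 4" .
  have "F t s ^ n \<le> F t s ^ 5" using F assms(3) by (intro power_increasing) auto
  also have "\<dots> \<le> exp T ^ 5" using assms F by (intro power_mono) auto
  finally have "12 * F t s ^ n \<le> exp T ^ 4 * exp T ^ 5" using 12 F by (intro mult_mono) auto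
  also have "\<dots> = exp (9 * T)" by (simp flip: exp_of_nat_mult exp_add)
  finally have "1 / exp (9 * T) \<le> 1 / (12 * F t s ^ n)" using F by (intro divide_left_mono) auto
  then show ?thesis by (simp add: exp_minus inverse_eq_divide)
qed

text \<open>
  The numerator contributes a factor \<open>1 / F\<close> to the first bound, and \<open>1 - \<kappa>\<close>, of order \<open>1 / F^2\<close>, to the
  other two; the denominator contributes \<open>1 / F^3\<close>. With \<open>12 \<le> e^(4 T)\<close> this leads to the exponent 9.
\<close>

lemma \<phi>st_lower_bounds:
  assumes T: "1 \<le> T" "F t s \<le> exp T" and far: "far_from_axis s" and \<epsilon>: "0 < \<epsilon>" "\<epsilon> < 1 / 16"
  shows "(t, s) \<notin> Znbhd a r \<beta> \<epsilon> \<Longrightarrow> \<epsilon>\<^sup>2 * exp (- 9 * T) \<le> \<bar>\<phi>st a r \<beta> t s\<bar>"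
    and "\<lbrakk>(t, s) \<in> Znbhd a r \<beta> \<epsilon>; s > s_plus a r \<beta> + \<epsilon> \<or> s < s_minus a r \<beta> - \<epsilon>; t \<noteq> t_crit a r \<beta> s\<rbrakk>
      \<Longrightarrow> \<epsilon> * exp (- 9 * T) \<le> \<bar>\<phi>st a r \<beta> t s\<bar> / \<bar>t - t_crit a r \<beta> s\<bar>"
    and "\<lbrakk>(t, s) \<in> Znbhd a r \<beta> \<epsilon>; t > t_plus a r \<beta> + \<epsilon> \<or> t < t_minus a r \<beta> - \<epsilon>; s \<noteq> s_crit a r \<beta> t\<rbrakk>
      \<Longrightarrow> \<epsilon> * exp (- 9 * T) \<le> \<bar>\<phi>st a r \<beta> t s\<bar> / \<bar>s - s_crit a r \<beta> t\<bar>"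
proof -
  have F: "1 < F t s" by (rule F_gt_1)
  show "\<epsilon>\<^sup>2 * exp (- 9 * T) \<le> \<bar>\<phi>st a r \<beta> t s\<bar>" if "(t, s) \<notin> Znbhd a r \<beta> \<epsilon>"
  proof -
    have "\<epsilon>\<^sup>2 * exp (- 9 * T) \<le> \<epsilon>\<^sup>2 * (1 / (12 * F t s ^ 4))"
      using const_exp_bound[OF T, of 4] by (intro mult_left_mono) auto
    also have "\<dots> = \<epsilon>\<^sup>2 / (12 * F t s) / F t s ^ 3" by (simp add: field_simps power_def)
    also have "\<dots> \<le> \<bar>N t s\<bar> / F t s ^ 3"
      using N_ge_outside_Znbhd[OF _ _ far that] \<epsilon> F by (intro divide_right_mono) auto
    also have "\<dots> \<le> \<bar>\<phi>st a r \<beta> t s\<bar>" by (rule \<phi>st_ge)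
    finally show ?thesis .
  qed
  have ratio: "\<epsilon> * exp (- 9 * T) \<le> \<bar>\<phi>st a r \<beta> t s\<bar> / d"
    if near: "(t, s) \<in> Znbhd a r \<beta> \<epsilon>" and N: "\<kappa> < 1 \<Longrightarrow> \<epsilon> * (1 - \<kappa>) / 2 * d \<le> \<bar>N t s\<bar>" and d: "0 < d" for d
  proof -
    have \<kappa>: "1 \<le> 6 * (F t s)\<^sup>2 * (1 - \<kappa>)" by (rule \<kappa>_gap_in_Znbhd[OF \<epsilon> far near])
    then have gap: "1 / (12 * (F t s)\<^sup>2) \<le> (1 - \<kappa>) / 2" using F by (simp add: field_simps)
    have "0 < 6 * (F t s)\<^sup>2 * (1 - \<kappa>)" using \<kappa> by linarith
    then have "\<kappa> < 1" using F by (simp add: zero_less_mult_iff)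
    note N = N[OF this]
    have "\<epsilon> * exp (- 9 * T) * d \<le> \<epsilon> * (1 / (12 * F t s ^ 5)) * d"
      using const_exp_bound[OF T, of 5] \<epsilon> d by (intro mult_right_mono mult_left_mono) auto
    also have "\<dots> = \<epsilon> * (1 / (12 * (F t s)\<^sup>2)) * d / F t s ^ 3"
      by (simp add: field_simps flip: power_add)
    also have "\<dots> \<le> \<epsilon> * ((1 - \<kappa>) / 2) * d / F t s ^ 3"
      using gap \<epsilon> d F by (intro divide_right_mono mult_right_mono mult_left_mono) auto
    also have "\<dots> \<le> \<bar>N t s\<bar> / F t s ^ 3" using N F by (intro divide_right_mono) auto
    also have "\<dots> \<le> \<bar>\<phi>st a r \<beta> t s\<bar>" by (rule \<phi>st_ge)
    finally show ?thesis using d by (simp add: le_divide_eq)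
  qed
  show "\<epsilon> * exp (- 9 * T) \<le> \<bar>\<phi>st a r \<beta> t s\<bar> / \<bar>t - t_crit a r \<beta> s\<bar>"
    if "(t, s) \<in> Znbhd a r \<beta> \<epsilon>" "s > s_plus a r \<beta> + \<epsilon> \<or> s < s_minus a r \<beta> - \<epsilon>" "t \<noteq> t_crit a r \<beta> s"
    using that \<epsilon> by (intro ratio N_ge_t_crit) auto
  show "\<epsilon> * exp (- 9 * T) \<le> \<bar>\<phi>st a r \<beta> t s\<bar> / \<bar>s - s_crit a r \<beta> t\<bar>"
    if "(t, s) \<in> Znbhd a r \<beta> \<epsilon>" "t > t_plus a r \<beta> + \<epsilon> \<or> t < t_minus a r \<beta> - \<epsilon>" "s \<noteq> s_crit a r \<beta> t"
    using that \<epsilon> by (intro ratio N_ge_s_crit) auto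
qed

end

section \<open>From the manifold to the coordinates\<close>

lemma le_inj_radius_quotient:
  fixes A \<rho> R :: real and i :: ereal
  assumes "A > 0" "ereal (\<rho> * A) \<le> i" "i / ereal A \<le> ereal R"
  shows "\<rho> \<le> R"
proof -
  have "ereal (\<rho> * A) / ereal A \<le> i / ereal A"
    using assms by (intro ereal_divide_right_mono) auto
  also have "ereal (\<rho> * A) / ereal A = ereal (\<rho> * A / A)"
    using assms(1) by (simp only: ereal_divide) (simp only: less_imp_neq[symmetric] if_False)
  also have "\<rho> * A / A = \<rho>" using assms(1) by simp
  finally have "ereal \<rho> \<le> ereal R" using assms(3) by (rule order_trans)
  then show ?thesis by simp
qed

lemma deck_maps_to_H3:
  assumes "\<alpha> \<in> deck p" "x \<in> H3"
  shows "\<alpha> x \<in> H3"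
proof -
  have "\<alpha> ` H3 = H3" using assms(1) by (auto simp only: deck_def homeomorphism_def mem_Collect_eq)
  then show ?thesis using assms(2) by blast
qed

text \<open>
  The Dirichlet domain contains its centre \<open>c 0\<close>, so a deck transformation that moves the domain off
  the tube moves \<open>c 0\<close> off the tube.
\<close>

lemma far_outside_deck_tube:
  assumes \<alpha>: "\<alpha> \<in> deck p - deck_tube p R c" and c: "range c \<subseteq> H3"
  shows "R < hdist (\<alpha> (c 0)) (c t)"
proof -
  have H: "c t \<in> H3" "\<alpha> (c t) \<in> H3" for t
  proof -
    show "c t \<in> H3" using c by blast
    then show "\<alpha> (c t) \<in> H3" by (rule deck_maps_to_H3[OF DiffD1[OF \<alpha>]])
  qed
  have "c 0 \<in> dirichlet_domain p (c 0)"
    unfolding dirichlet_domain_def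
  proof (intro CollectI conjI ballI)
    show c0: "c 0 \<in> H3" by (rule H)
    fix \<alpha>' assume "\<alpha>' \<in> deck p"
    then have "\<alpha>' (c 0) \<in> H3" using c0 by (rule deck_maps_to_H3)
    then show "hdist (c 0) (c 0) \<le> hdist (c 0) (\<alpha>' (c 0))"
      using c0 by (simp add: hdist_self hdist_nonneg)
  qed
  then have "\<alpha> (c 0) \<notin> tube R c"
    using \<alpha> unfolding deck_tube_def by blast
  then have "R < (INF t. hdist (\<alpha> (c 0)) (c t))" using H(2)[of 0] unfolding tube_def by simp
  also have "\<dots> \<le> hdist (\<alpha> (c 0)) (c t)"
    by (intro cINF_lower bdd_belowI2[of _ 0] hdist_nonneg H UNIV_I)
  finally show ?thesis .
qed

text \<open>
  With \<open>R \<ge> 4\<close>, the value of \<open>F\<close> is at least \<open>cosh 4 \<ge> e^4 / 2 \<ge> 4 e\<close> at one point of the segment and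
  every \<open>t\<close>, hence at least 4 on the whole segment.
\<close>

lemma far_from_axis_and_bounded:
  assumes \<alpha>: "\<alpha> \<in> deck p - deck_tube p R c" and c: "range c \<subseteq> H3" and R: "4 \<le> R"
    and T: "\<forall>t\<in>{0..1}. \<forall>s\<in>{0..1}. hdist (c t) (\<alpha> (c s)) \<le> T"
    and skew: "\<not> coplanar_sets (range c) (range (\<alpha> \<circ> c))"
    and coords: "adapted_coordinates \<Psi> c \<alpha> a r \<beta> b"
  shows "geodesic_pair a r \<beta>"
    and "s \<in> {b..b+1} \<Longrightarrow> geodesic_pair.far_from_axis a r \<beta> s"
    and "t \<in> {0..1} \<Longrightarrow> s \<in> {b..b+1} \<Longrightarrow> geodesic_pair.F a r \<beta> t s \<le> exp T"
proof -
  have H: "c t \<in> H3" "\<alpha> (c t) \<in> H3" for t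
  proof -
    show "c t \<in> H3" using c by blast
    then show "\<alpha> (c t) \<in> H3" by (rule deck_maps_to_H3[OF DiffD1[OF \<alpha>]])
  qed
  have \<Psi>: "hisometry \<Psi>" and \<gamma>1: "\<Psi> (c t) = \<gamma>1 t"
    and seg: "(\<lambda>s. \<Psi> (\<alpha> (c s))) ` {0..1} = \<gamma>2 a r \<beta> ` {b..b+1}"
    and line: "range (\<lambda>s. \<Psi> (\<alpha> (c s))) = range (\<gamma>2 a r \<beta>)" for t
    using coords by (auto simp: adapted_coordinates_def)
  have iso: "hdist (\<Psi> x) (\<Psi> y) = hdist x y" if "x \<in> H3" "y \<in> H3" for x y
    using \<Psi> that by (simp add: hisometry_def)
  have "a \<noteq> 0"
  proof
    assume "a = 0"
    then have "coplanar_sets (range c) (range (\<alpha> \<circ> c))"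
      using \<gamma>1 line H by (intro coplanar_if_concentric[OF \<Psi>]) auto
    with skew show False ..
  qed
  then show "geodesic_pair a r \<beta>"
    using coords by (simp add: adapted_coordinates_def geodesic_pair_def)
  then interpret geodesic_pair a r \<beta> .
  have F: "F t s = cosh (\<phi> a r \<beta> t s)" for t s
    using F_gt_1[of t s] by (simp add: \<phi>_eq)
  show "F t s \<le> exp T" if t: "t \<in> {0..1}" and s: "s \<in> {b..b+1}"
  proof -
    have "\<gamma>2 a r \<beta> s \<in> (\<lambda>s. \<Psi> (\<alpha> (c s))) ` {0..1}" using s seg by blast
    then obtain s' where s': "s' \<in> {0..1}" "\<gamma>2 a r \<beta> s = \<Psi> (\<alpha> (c s'))" by blast
    then have "\<phi> a r \<beta> t s = hdist (c t) (\<alpha> (c s'))"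
      by (simp add: \<phi>_def iso H flip: \<gamma>1)
    then have "0 \<le> \<phi> a r \<beta> t s" "\<phi> a r \<beta> t s \<le> T" using T t s'(1) H(1)[of t] H(2)[of s'] by (simp_all add: hdist_nonneg)
    then have "0 \<le> T" "F t s \<le> cosh T" unfolding F by (auto simp: cosh_real_nonneg_le_iff)
    note this(2)
    also have "cosh T \<le> exp T" using \<open>0 \<le> T\<close> cosh_plus_sinh[of T] sinh_real_nonneg_iff[of T] by linarith
    finally show ?thesis .
  qed
  show "far_from_axis s" if s: "s \<in> {b..b+1}"
  proof (rule far_from_axisI)
    fix t
    have "\<Psi> (\<alpha> (c 0)) \<in> \<gamma>2 a r \<beta> ` {b..b+1}" using seg by force
    then obtain s' where s': "s' \<in> {b..b+1}" "\<Psi> (\<alpha> (c 0)) = \<gamma>2 a r \<beta> s'" by blast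
    have "\<phi> a r \<beta> t s' = hdist (\<alpha> (c 0)) (c t)"
      using iso[OF H(2)[of 0] H(1)[of t]] by (simp add: \<phi>_def s'(2) \<gamma>1 hdist_\<gamma>_commute)
    then have "4 \<le> \<phi> a r \<beta> t s'" using far_outside_deck_tube[OF \<alpha> c, of t] R by simp
    then have "cosh 4 \<le> F t s'" unfolding F by (simp add: cosh_real_nonneg_le_iff)
    also have "F t s' \<le> exp 1 * F t s" using s s'(1) by (intro F_Harnack) auto
    finally have 1: "cosh 4 \<le> exp 1 * F t s" .
    have "(2::real) \<le> exp 1" using exp_ge_add_one_self[of 1] by simp
    then have "(2::real) ^ 3 \<le> exp 1 ^ 3" by (rule power_mono) simp
    then have "8 * exp 1 \<le> exp 1 ^ 3 * (exp 1 :: real)" by (intro mult_right_mono) auto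
    also have "\<dots> = exp 4" by (simp flip: exp_of_nat_mult exp_add)
    also have "\<dots> \<le> 2 * cosh (4::real)" by (simp add: cosh_field_def)
    finally have "4 * exp 1 \<le> exp 1 * F t s" using 1 by linarith
    then show "3 \<le> F t s" by simp
  qed
qed

theorem lemma3:
  fixes A :: real
  assumes "A \<ge> 1"
  shows "\<exists>\<rho>0>0. \<forall>(M :: 'm::metric_space set) p c R.
    compact_hyperbolic_3manifold M p \<and> ereal \<rho>0 \<le> inj_radius p \<and>
    inj_radius p / ereal A \<le> ereal R \<and> ereal R \<le> ereal A * inj_radius p \<and>
    unit_speed_geodesic c \<longrightarrow>
    (\<exists>C>0. \<exists>T0>0. \<exists>\<epsilon>0>0. \<forall>T\<ge>T0. \<forall>\<epsilon>. 0 < \<epsilon> \<and> \<epsilon> < \<epsilon>0 \<longrightarrow>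
      (\<forall>\<alpha> \<Psi> a r \<beta> b.
        \<alpha> \<in> deck p - deck_tube p R c \<and>
        (\<forall>t\<in>{0..1}. \<forall>s\<in>{0..1}. 2 \<le> hdist (c t) (\<alpha> (c s)) \<and> hdist (c t) (\<alpha> (c s)) \<le> T) \<and>
        \<not> coplanar_sets (range c) (range (\<alpha> \<circ> c)) \<and>
        adapted_coordinates \<Psi> c \<alpha> a r \<beta> b \<longrightarrow>
        (INF (t, s) \<in> {0..1} \<times> {b..b+1} - Znbhd a r \<beta> \<epsilon>. ereal \<bar>\<phi>st a r \<beta> t s\<bar>)
          \<ge> ereal (\<epsilon>^2 * exp (- C * T)) \<and>
        (Zset a r \<beta> \<noteq> {} \<longrightarrow>
          (INF (t, s) \<in> ({0..1} \<times> {b..b+1}) \<inter>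
              {(t, s) \<in> Znbhd a r \<beta> \<epsilon>. (s > s_plus a r \<beta> + \<epsilon> \<or> s < s_minus a r \<beta> - \<epsilon>) \<and>
                 t \<noteq> t_crit a r \<beta> s}.
             ereal (\<bar>\<phi>st a r \<beta> t s\<bar> / \<bar>t - t_crit a r \<beta> s\<bar>))
            \<ge> ereal (\<epsilon> * exp (- C * T)) \<and>
          (INF (t, s) \<in> ({0..1} \<times> {b..b+1}) \<inter>
              {(t, s) \<in> Znbhd a r \<beta> \<epsilon>. (t > t_plus a r \<beta> + \<epsilon> \<or> t < t_minus a r \<beta> - \<epsilon>) \<and>
                 s \<noteq> s_crit a r \<beta> t}.
             ereal (\<bar>\<phi>st a r \<beta> t s\<bar> / \<bar>s - s_crit a r \<beta> t\<bar>))
            \<ge> ereal (\<epsilon> * exp (- C * T)))))"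
proof (rule exI[of _ "4 * A"], intro conjI allI impI)
  fix M :: "'m set" and p c R
  assume "compact_hyperbolic_3manifold M p \<and> ereal (4 * A) \<le> inj_radius p \<and>
    inj_radius p / ereal A \<le> ereal R \<and> ereal R \<le> ereal A * inj_radius p \<and>
    unit_speed_geodesic c"
  then have "ereal (4 * A) \<le> inj_radius p" "inj_radius p / ereal A \<le> ereal R"
    and c: "range c \<subseteq> H3" by (simp_all add: unit_speed_geodesic_def)
  then have R: "4 \<le> R" using assms by (intro le_inj_radius_quotient[of A]) auto
  show "\<exists>C>0. \<exists>T0>0. \<exists>\<epsilon>0>0. \<forall>T\<ge>T0. \<forall>\<epsilon>. 0 < \<epsilon> \<and> \<epsilon> < \<epsilon>0 \<longrightarrow>
      (\<forall>\<alpha> \<Psi> a r \<beta> b.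
        \<alpha> \<in> deck p - deck_tube p R c \<and>
        (\<forall>t\<in>{0..1}. \<forall>s\<in>{0..1}. 2 \<le> hdist (c t) (\<alpha> (c s)) \<and> hdist (c t) (\<alpha> (c s)) \<le> T) \<and>
        \<not> coplanar_sets (range c) (range (\<alpha> \<circ> c)) \<and>
        adapted_coordinates \<Psi> c \<alpha> a r \<beta> b \<longrightarrow>
        (INF (t, s) \<in> {0..1} \<times> {b..b+1} - Znbhd a r \<beta> \<epsilon>. ereal \<bar>\<phi>st a r \<beta> t s\<bar>)
          \<ge> ereal (\<epsilon>^2 * exp (- C * T)) \<and>
        (Zset a r \<beta> \<noteq> {} \<longrightarrow>
          (INF (t, s) \<in> ({0..1} \<times> {b..b+1}) \<inter>
              {(t, s) \<in> Znbhd a r \<beta> \<epsilon>. (s > s_plus a r \<beta> + \<epsilon> \<or> s < s_minus a r \<beta> - \<epsilon>) \<and>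
                 t \<noteq> t_crit a r \<beta> s}.
             ereal (\<bar>\<phi>st a r \<beta> t s\<bar> / \<bar>t - t_crit a r \<beta> s\<bar>))
            \<ge> ereal (\<epsilon> * exp (- C * T)) \<and>
          (INF (t, s) \<in> ({0..1} \<times> {b..b+1}) \<inter>
              {(t, s) \<in> Znbhd a r \<beta> \<epsilon>. (t > t_plus a r \<beta> + \<epsilon> \<or> t < t_minus a r \<beta> - \<epsilon>) \<and>
                 s \<noteq> s_crit a r \<beta> t}.
             ereal (\<bar>\<phi>st a r \<beta> t s\<bar> / \<bar>s - s_crit a r \<beta> t\<bar>))
            \<ge> ereal (\<epsilon> * exp (- C * T))))"
  proof (rule exI[of _ 9], rule conjI, simp, rule exI[of _ 1], rule conjI, simp,
      rule exI[of _ "1 / 16"], intro conjI allI impI)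
    fix T \<epsilon> :: real and \<alpha> \<Psi> a r \<beta> b
    assume T: "1 \<le> T" and \<epsilon>: "0 < \<epsilon> \<and> \<epsilon> < 1 / 16"
      and asm: "\<alpha> \<in> deck p - deck_tube p R c \<and>
        (\<forall>t\<in>{0..1}. \<forall>s\<in>{0..1}. 2 \<le> hdist (c t) (\<alpha> (c s)) \<and> hdist (c t) (\<alpha> (c s)) \<le> T) \<and>
        \<not> coplanar_sets (range c) (range (\<alpha> \<circ> c)) \<and>
        adapted_coordinates \<Psi> c \<alpha> a r \<beta> b"
    from asm have "\<alpha> \<in> deck p - deck_tube p R c"
      and "\<forall>t\<in>{0..1}. \<forall>s\<in>{0..1}. hdist (c t) (\<alpha> (c s)) \<le> T"
      and "\<not> coplanar_sets (range c) (range (\<alpha> \<circ> c))" "adapted_coordinates \<Psi> c \<alpha> a r \<beta> b"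
      by simp_all
    note * = far_from_axis_and_bounded[OF this(1) c R this(2-)]
    interpret geodesic_pair a r \<beta> by (rule *(1))
    have \<epsilon>': "0 < \<epsilon>" "\<epsilon> < 1 / 16" using \<epsilon> by auto
    note bounds = \<phi>st_lower_bounds[OF T *(3,2) \<epsilon>']

    show "ereal (\<epsilon>\<^sup>2 * exp (- 9 * T))
        \<le> (INF (t, s) \<in> {0..1} \<times> {b..b+1} - Znbhd a r \<beta> \<epsilon>. ereal \<bar>\<phi>st a r \<beta> t s\<bar>)"
    proof (rule INF_greatest, goal_cases)
      case (1 z)
      then obtain t s where z: "z = (t, s)" and "t \<in> {0..1}" "s \<in> {b..b+1}" "(t, s) \<notin> Znbhd a r \<beta> \<epsilon>"
        by (cases z) blast
      from bounds(1)[OF this(2,3,3,4-)] show ?case unfolding z by simp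
    qed
    show "ereal (\<epsilon> * exp (- 9 * T))
        \<le> (INF (t, s) \<in> ({0..1} \<times> {b..b+1}) \<inter>
              {(t, s) \<in> Znbhd a r \<beta> \<epsilon>. (s > s_plus a r \<beta> + \<epsilon> \<or> s < s_minus a r \<beta> - \<epsilon>) \<and>
                 t \<noteq> t_crit a r \<beta> s}.
             ereal (\<bar>\<phi>st a r \<beta> t s\<bar> / \<bar>t - t_crit a r \<beta> s\<bar>))"
    proof (rule INF_greatest, goal_cases)
      case (1 z)
      then obtain t s where z: "z = (t, s)" and "t \<in> {0..1}" "s \<in> {b..b+1}" "(t, s) \<in> Znbhd a r \<beta> \<epsilon>"
        "s > s_plus a r \<beta> + \<epsilon> \<or> s < s_minus a r \<beta> - \<epsilon>" "t \<noteq> t_crit a r \<beta> s"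
        by (cases z) blast
      from bounds(2)[OF this(2,3,3,4-)] show ?case unfolding z by simp
    qed
    show "ereal (\<epsilon> * exp (- 9 * T))
        \<le> (INF (t, s) \<in> ({0..1} \<times> {b..b+1}) \<inter>
              {(t, s) \<in> Znbhd a r \<beta> \<epsilon>. (t > t_plus a r \<beta> + \<epsilon> \<or> t < t_minus a r \<beta> - \<epsilon>) \<and>
                 s \<noteq> s_crit a r \<beta> t}.
             ereal (\<bar>\<phi>st a r \<beta> t s\<bar> / \<bar>s - s_crit a r \<beta> t\<bar>))"
    proof (rule INF_greatest, goal_cases)
      case (1 z)
      then obtain t s where z: "z = (t, s)" and "t \<in> {0..1}" "s \<in> {b..b+1}" "(t, s) \<in> Znbhd a r \<beta> \<epsilon>"
        "t > t_plus a r \<beta> + \<epsilon> \<or> t < t_minus a r \<beta> - \<epsilon>" "s \<noteq> s_crit a r \<beta> t"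
        by (cases z) blast
      from bounds(3)[OF this(2,3,3,4-)] show ?case unfolding z by simp
    qed
  qed auto
qed (use assms in auto)

end
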